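(* Let $T\subset\mathbb{R}^3$ be a convex polyhedron satisfying the assumptions in the context, and let $\mathcal{M}\Lambda^1(T)$ and the set $\mathcal{E}^+$ of oriented edges of $T$ be as defined in the context. Then there exists a computable basis $\{\mathbf{p}_e,\ e\in\mathcal{E}^+\}$ for $\mathcal{M}\Lambda^1(T)$ such that on each $e'\in\mathcal{E}^+$, $$\mathbf{p}_e\cdot\mathbf{t}_{e'}|_{e'}=\begin{cases}1&\text{if }e=e',\\0&\text{otherwise.}\end{cases}$$ Therefore the dimension of $\mathcal{M}\Lambda^1(T)$ is equal to the number of edges of $T$.
   Context: $T\subset\mathbb{R}^3$ is a (closed) convex polyhedron with vertices $\mathbf{v}_1,\dots,\mathbf{v}_n$. Generalized barycentric coordinates on $T$ are functions $\lambda_1,\dots,\lambda_n$ on $T$, non-negative, with $L(\mathbf{x})=\sum_i L(\mathbf{v}_i)\lambda_i(\mathbf{x})$ for every affine $L$ and all $\mathbf{x}\in T$. Assumption 1: $\lambda_i(\mathbf{v}_j)=\delta_{ij}$; $\lambda_i\in C^1(T)$ (up to the boundary); on each face $f$, the $\lambda_i$ with $\mathbf{v}_i\in f$ restrict to 2D generalized barycentric coordinates of the polygon $f$ which again satisfy the Lagrange property, are $C^1$ on $f$ and are linear on each edge of $f$, while $\lambda_i|_f=0$ if $\mathbf{v}_i\notin f$. Assumption 2: every face $f$ is a triangle or a parallelogram, and if its vertices are $\mathbf{v}_{i_1},\mathbf{v}_{i_2},\dots$ in counterclockwise order seen from outside $T$, $D_{ab}:=(\nabla\lambda_{i_a}\times\nabla\lambda_{i_b})\cdot\mathbf{n}_f|_f$,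 and $|f|$ is the area, then $D_{12}=D_{23}=D_{31}=\frac1{2|f|}$ for a triangle, and $D_{12}+D_{34}=D_{23}+D_{41}=\frac1{|f|}$ for a parallelogram. Here $\mathbf{n}_f$ is the unit outward normal on $f$. Whitney 1-forms: $W_{ij}=\lambda_i\nabla\lambda_j-\lambda_j\nabla\lambda_i$. For $i\ne j$, $e_{ij}$ is the directed segment from $\mathbf{v}_i$ to $\mathbf{v}_j$ and $\boldsymbol{\tau}_{ij}=\mathbf{v}_j-\mathbf{v}_i$. $\mathcal{E}$ is the set of $e_{ij}$ that are edges of $T$ (both directions included), $\mathcal{E}_F$ the set of $e_{ij}$ lying on $\partial T$ but not in $\mathcal{E}$, $\mathcal{E}_I$ the set of remaining $e_{ij}$ (not lying on $\partial T$). $\mathcal{E}^+\subset\mathcal{E}$ contains each edge of $T$ exactly once, with a prefixed direction; $\mathbf{t}_e$ is the unit tangent vector of $e\in\mathcal{E}^+$ in its direction. For $e_{ij}\in\mathcal{E}$, $\mathcal{V}_{ij}$ is the set of all vertices of the two faces sharing $e_{ij}$. For each $e_{ik}\in\mathcal{E}_I$ fix once and for all coefficients $C^{ik}_{ij}$ with $\boldsymbol{\tau}_{ik}=\sum_{j,\,e_{ij}\in\mathcal{E}}C^{ik}_{ij}\boldsymbol{\tau}_{ij}$. For $e_{ij}\in\mathcal{E}$ define $$\tilde W_{ij}=W_{ij}+\tfrac12\Big(\sum_{\mathbf{v}_k\in\mathcal{V}_{ij},\,e_{ik}\in\mathcal{E}_F}W_{ik}-\sum_{\mathbf{v}_k\in\mathcal{V}_{ij},\,e_{jk}\in\mathcal{E}_F}W_{jk}\Big)+\tfrac12\Big(\sum_{k,\,e_{ik}\in\mathcal{E}_I}C^{ik}_{ij}W_{ik}-\sum_{k,\,e_{jk}\in\mathcal{E}_I}C^{jk}_{ji}W_{jk}\Big).$$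 $\mathcal{F}$ is the set of faces of $T$; $\partial f$ is the boundary of $f$ oriented by the right-hand rule with $\mathbf{n}_f$; $e_{ij}\in\partial f$ means that $e_{ij}$ is an edge of $f$ directed according to this orientation. Define $\tilde W_f=\sum_{e_{ij}\in\partial f}\tilde W_{ij}$ and $$\mathcal{M}\Lambda^1(T)=\mathrm{span}\{\nabla\lambda_i,\ 1\le i\le n\}+\mathrm{span}\{\tilde W_f,\ f\in\mathcal{F}\}.$$ "Computable" means that each $\mathbf{p}_e$ can be written as a linear combination of the $\nabla\lambda_i$, $1\le i\le n$, and the $\tilde W_f$, $f\in\mathcal{F}$, with coefficients obtained by solving an explicit finite linear system. *)

theory Defs
  imports "HOL-Analysis.Analysis" "HOL-Library.Function_Algebras"
begin

text \<open>Pointwise real vector space structure on functions, so that \<open>span\<close>, \<open>independent\<close>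
  and \<open>dim\<close> of the library apply to vector fields.\<close>

instantiation "fun" :: (type, real_vector) real_vector
begin

definition scaleR_fun :: "real \<Rightarrow> ('a \<Rightarrow> 'b) \<Rightarrow> 'a \<Rightarrow> 'b"
  where "scaleR_fun c u = (\<lambda>x. c *\<^sub>R u x)"

instance
  by standard (auto simp: fun_eq_iff scaleR_fun_def scaleR_add_left scaleR_add_right)

end

section \<open>Generalized barycentric coordinates\<close>

definition affine_fun :: "('a::euclidean_space \<Rightarrow> real) \<Rightarrow> bool" where
  "affine_fun L \<longleftrightarrow> (\<exists>a b. \<forall>x. L x = a \<bullet> x + b)"

text \<open>The definition also covers a polygon \<open>S\<close> in \<open>\<real>\<^sup>3\<close>: the affine functions on the plane of \<open>S\<close>
  are the restrictions of the affine functions on \<open>\<real>\<^sup>3\<close>.\<close>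

definition gbc ::
  "'a::euclidean_space set \<Rightarrow> nat set \<Rightarrow> (nat \<Rightarrow> 'a) \<Rightarrow> (nat \<Rightarrow> 'a \<Rightarrow> real) \<Rightarrow> bool" where
  "gbc S I v lam \<longleftrightarrow>
     (\<forall>i\<in>I. \<forall>x\<in>S. 0 \<le> lam i x) \<and>
     (\<forall>L. affine_fun L \<longrightarrow> (\<forall>x\<in>S. L x = (\<Sum>i\<in>I. L (v i) * lam i x)))"

definition lagrange_at :: "nat set \<Rightarrow> (nat \<Rightarrow> 'a) \<Rightarrow> (nat \<Rightarrow> 'a \<Rightarrow> real) \<Rightarrow> bool" where
  "lagrange_at I v lam \<longleftrightarrow> (\<forall>i\<in>I. \<forall>j\<in>I. lam i (v j) = (if i = j then 1 else 0))"

text \<open>\<open>C\<^sup>1\<close> up to the boundary: differentiable relative to \<open>S\<close> at every point of \<open>S\<close>, with continuous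
  gradient. If \<open>S\<close> is a planar polygon in \<open>\<real>\<^sup>3\<close>, only the component of \<open>g\<close> parallel to the plane is
  determined, and this is the two-dimensional notion on \<open>S\<close>.\<close>

definition C1_on :: "'a::euclidean_space set \<Rightarrow> ('a \<Rightarrow> real) \<Rightarrow> bool" where
  "C1_on S u \<longleftrightarrow>
     (\<exists>g. continuous_on S g \<and> (\<forall>x\<in>S. (u has_derivative (\<lambda>h. g x \<bullet> h)) (at x within S)))"

text \<open>The gradient on \<open>T\<close>, one-sided at boundary points. On a convex set with interior points the
  derivative relative to the set is unique also at boundary points. All fields built from it vanish
  off \<open>T\<close>, so that they represent fields on \<open>T\<close> and equality of functions is equality on \<open>T\<close>.\<close>

definition grad_on :: "(real^3) set \<Rightarrow> (real^3 \<Rightarrow> real) \<Rightarrow> real^3 \<Rightarrow> real^3" where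
  "grad_on T u x =
     (if x \<in> T then (\<chi> m. frechet_derivative u (at x within T) (axis m 1)) else 0)"

section \<open>Polyhedra: vertices, edges, faces\<close>

definition convex_polyhedron :: "(real^3) set \<Rightarrow> nat \<Rightarrow> (nat \<Rightarrow> real^3) \<Rightarrow> bool" where
  "convex_polyhedron T n v \<longleftrightarrow>
     polytope T \<and> interior T \<noteq> {} \<and> bij_betw v {1..n} {x. x extreme_point_of T}"

definition tau :: "(nat \<Rightarrow> real^3) \<Rightarrow> nat \<Rightarrow> nat \<Rightarrow> real^3" where
  "tau v i j = v j - v i"

definition unit_tangent :: "(nat \<Rightarrow> real^3) \<Rightarrow> nat \<times> nat \<Rightarrow> real^3" where
  "unit_tangent v e = tau v (fst e) (snd e) /\<^sub>R norm (tau v (fst e) (snd e))"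

text \<open>The directed segment \<open>e\<^sub>i\<^sub>j\<close> is encoded by the pair \<open>(i, j)\<close>.\<close>

definition seg :: "(nat \<Rightarrow> real^3) \<Rightarrow> nat \<times> nat \<Rightarrow> (real^3) set" where
  "seg v e = closed_segment (v (fst e)) (v (snd e))"

definition directed_segs :: "nat \<Rightarrow> (nat \<times> nat) set" where
  "directed_segs n = {(i, j). i \<in> {1..n} \<and> j \<in> {1..n} \<and> i \<noteq> j}"

definition edges :: "(real^3) set \<Rightarrow> nat \<Rightarrow> (nat \<Rightarrow> real^3) \<Rightarrow> (nat \<times> nat) set" where
  "edges T n v = {e \<in> directed_segs n. seg v e edge_of T}"

definition face_diagonals :: "(real^3) set \<Rightarrow> nat \<Rightarrow> (nat \<Rightarrow> real^3) \<Rightarrow> (nat \<times> nat) set" where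
  "face_diagonals T n v = {e \<in> directed_segs n. seg v e \<subseteq> frontier T} - edges T n v"

definition interior_diagonals :: "(real^3) set \<Rightarrow> nat \<Rightarrow> (nat \<Rightarrow> real^3) \<Rightarrow> (nat \<times> nat) set" where
  "interior_diagonals T n v = {e \<in> directed_segs n. \<not> seg v e \<subseteq> frontier T}"

definition edge_orientation ::
  "(real^3) set \<Rightarrow> nat \<Rightarrow> (nat \<Rightarrow> real^3) \<Rightarrow> (nat \<times> nat) set \<Rightarrow> bool" where
  "edge_orientation T n v Ep \<longleftrightarrow>
     Ep \<subseteq> edges T n v \<and> (\<forall>(i, j)\<in>edges T n v. (i, j) \<in> Ep \<longleftrightarrow> (j, i) \<notin> Ep)"

definition faces :: "(real^3) set \<Rightarrow> (real^3) set set" where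
  "faces T = {f. f facet_of T}"

definition face_verts :: "nat \<Rightarrow> (nat \<Rightarrow> real^3) \<Rightarrow> (real^3) set \<Rightarrow> nat set" where
  "face_verts n v f = {i \<in> {1..n}. v i \<in> f}"

definition outward_normal :: "(real^3) set \<Rightarrow> (real^3) set \<Rightarrow> real^3" where
  "outward_normal T f =
     (THE \<nu>. norm \<nu> = 1 \<and> (\<forall>x\<in>f. \<forall>y\<in>f. \<nu> \<bullet> (y - x) = 0) \<and> (\<forall>x\<in>f. \<forall>y\<in>T. \<nu> \<bullet> (y - x) \<le> 0))"

text \<open>Right-hand rule: seen from outside \<open>T\<close>, the face lies to the left of each of its directed
  boundary edges.\<close>

definition face_boundary ::
  "(real^3) set \<Rightarrow> nat \<Rightarrow> (nat \<Rightarrow> real^3) \<Rightarrow> (real^3) set \<Rightarrow> (nat \<times> nat) set" where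
  "face_boundary T n v f =
     {(i, j) \<in> directed_segs n. seg v (i, j) edge_of f \<and>
        (\<forall>x\<in>f. 0 \<le> cross3 (tau v i j) (x - v i) \<bullet> outward_normal T f)}"

text \<open>The list \<open>vs\<close> enumerates the vertices of \<open>f\<close> once each, counterclockwise seen from outside.\<close>

definition ccw_vertices ::
  "(real^3) set \<Rightarrow> nat \<Rightarrow> (nat \<Rightarrow> real^3) \<Rightarrow> (real^3) set \<Rightarrow> nat list \<Rightarrow> bool" where
  "ccw_vertices T n v f vs \<longleftrightarrow>
     distinct vs \<and> set vs = face_verts n v f \<and>
     (\<forall>m<length vs. (vs ! m, vs ! (Suc m mod length vs)) \<in> face_boundary T n v f)"

definition is_triangle :: "(real^3) set \<Rightarrow> bool" where
  "is_triangle f \<longleftrightarrow> (\<exists>a b c. \<not> collinear {a, b, c} \<and> f = convex hull {a, b, c})"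

definition is_parallelogram :: "(real^3) set \<Rightarrow> bool" where
  "is_parallelogram f \<longleftrightarrow>
     (\<exists>a p q. \<not> collinear {0, p, q} \<and> f = convex hull {a, a + p, a + p + q, a + q})"

text \<open>Area of a planar set: its Lebesgue measure after an isometric identification of its plane with
  \<open>\<real>\<^sup>2\<close>; the value does not depend on the chosen isometry.\<close>

definition planar_area :: "(real^3) set \<Rightarrow> real" where
  "planar_area f =
     measure lebesgue
       ((SOME g :: real^2 \<Rightarrow> real^3. (\<forall>p q. dist (g p) (g q) = dist p q) \<and> f \<subseteq> range g) -` f)"

section \<open>The standing assumptions\<close>

definition assumption1 ::
  "(real^3) set \<Rightarrow> nat \<Rightarrow> (nat \<Rightarrow> real^3) \<Rightarrow> (nat \<Rightarrow> real^3 \<Rightarrow> real) \<Rightarrow> bool" where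
  "assumption1 T n v lam \<longleftrightarrow>
     lagrange_at {1..n} v lam \<and>
     (\<forall>i\<in>{1..n}. C1_on T (lam i)) \<and>
     (\<forall>f\<in>faces T.
        gbc f (face_verts n v f) v lam \<and>
        lagrange_at (face_verts n v f) v lam \<and>
        (\<forall>i\<in>face_verts n v f. C1_on f (lam i)) \<and>
        (\<forall>i\<in>face_verts n v f. \<forall>e. e edge_of f \<longrightarrow> (\<exists>L. affine_fun L \<and> (\<forall>x\<in>e. lam i x = L x))) \<and>
        (\<forall>i\<in>{1..n} - face_verts n v f. \<forall>x\<in>f. lam i x = 0))"

definition face_D ::
  "(real^3) set \<Rightarrow> (nat \<Rightarrow> real^3 \<Rightarrow> real) \<Rightarrow> (real^3) set \<Rightarrow> nat \<Rightarrow> nat \<Rightarrow> real^3 \<Rightarrow> real" where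
  "face_D T lam f i j x = cross3 (grad_on T (lam i) x) (grad_on T (lam j) x) \<bullet> outward_normal T f"

definition assumption2 ::
  "(real^3) set \<Rightarrow> nat \<Rightarrow> (nat \<Rightarrow> real^3) \<Rightarrow> (nat \<Rightarrow> real^3 \<Rightarrow> real) \<Rightarrow> bool" where
  "assumption2 T n v lam \<longleftrightarrow>
     (\<forall>f\<in>faces T.
        (is_triangle f \<or> is_parallelogram f) \<and>
        (\<forall>i1 i2 i3. is_triangle f \<and> ccw_vertices T n v f [i1, i2, i3] \<longrightarrow>
           (\<forall>x\<in>f. face_D T lam f i1 i2 x = 1 / (2 * planar_area f) \<and>
                  face_D T lam f i2 i3 x = 1 / (2 * planar_area f) \<and>
                  face_D T lam f i3 i1 x = 1 / (2 * planar_area f))) \<and>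
        (\<forall>i1 i2 i3 i4. is_parallelogram f \<and> ccw_vertices T n v f [i1, i2, i3, i4] \<longrightarrow>
           (\<forall>x\<in>f. face_D T lam f i1 i2 x + face_D T lam f i3 i4 x = 1 / planar_area f \<and>
                  face_D T lam f i2 i3 x + face_D T lam f i4 i1 x = 1 / planar_area f)))"

section \<open>Whitney forms and the space \<open>M\<Lambda>\<^sup>1(T)\<close>\<close>

definition whitney ::
  "(real^3) set \<Rightarrow> (nat \<Rightarrow> real^3 \<Rightarrow> real) \<Rightarrow> nat \<Rightarrow> nat \<Rightarrow> real^3 \<Rightarrow> real^3" where
  "whitney T lam i j =
     (\<lambda>x. lam i x *\<^sub>R grad_on T (lam j) x - lam j x *\<^sub>R grad_on T (lam i) x)"

text \<open>\<open>edge_nbhd_verts T n v i j\<close> is the set of (indices of) vertices of the two faces sharing the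
  edge \<open>e\<^sub>i\<^sub>j\<close>.\<close>

definition edge_nbhd_verts ::
  "(real^3) set \<Rightarrow> nat \<Rightarrow> (nat \<Rightarrow> real^3) \<Rightarrow> nat \<Rightarrow> nat \<Rightarrow> nat set" where
  "edge_nbhd_verts T n v i j = (\<Union>f\<in>{f \<in> faces T. seg v (i, j) \<subseteq> f}. face_verts n v f)"

text \<open>\<open>C i k j\<close> stands for the coefficient of \<open>tau v i j\<close> in the expansion of \<open>tau v i k\<close>.\<close>

definition diagonal_coeffs ::
  "(real^3) set \<Rightarrow> nat \<Rightarrow> (nat \<Rightarrow> real^3) \<Rightarrow> (nat \<Rightarrow> nat \<Rightarrow> nat \<Rightarrow> real) \<Rightarrow> bool" where
  "diagonal_coeffs T n v C \<longleftrightarrow>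
     (\<forall>(i, k)\<in>interior_diagonals T n v.
        tau v i k = (\<Sum>j | (i, j) \<in> edges T n v. C i k j *\<^sub>R tau v i j))"

definition whitney_mod ::
  "(real^3) set \<Rightarrow> nat \<Rightarrow> (nat \<Rightarrow> real^3) \<Rightarrow> (nat \<Rightarrow> real^3 \<Rightarrow> real) \<Rightarrow>
   (nat \<Rightarrow> nat \<Rightarrow> nat \<Rightarrow> real) \<Rightarrow> nat \<Rightarrow> nat \<Rightarrow> real^3 \<Rightarrow> real^3" where
  "whitney_mod T n v lam C i j =
     whitney T lam i j
     + (1/2) *\<^sub>R
       ((\<Sum>k | k \<in> edge_nbhd_verts T n v i j \<and> (i, k) \<in> face_diagonals T n v. whitney T lam i k)
        - (\<Sum>k | k \<in> edge_nbhd_verts T n v i j \<and> (j, k) \<in> face_diagonals T n v. whitney T lam j k))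
     + (1/2) *\<^sub>R
       ((\<Sum>k | (i, k) \<in> interior_diagonals T n v. C i k j *\<^sub>R whitney T lam i k)
        - (\<Sum>k | (j, k) \<in> interior_diagonals T n v. C j k i *\<^sub>R whitney T lam j k))"

definition whitney_face ::
  "(real^3) set \<Rightarrow> nat \<Rightarrow> (nat \<Rightarrow> real^3) \<Rightarrow> (nat \<Rightarrow> real^3 \<Rightarrow> real) \<Rightarrow>
   (nat \<Rightarrow> nat \<Rightarrow> nat \<Rightarrow> real) \<Rightarrow> (real^3) set \<Rightarrow> real^3 \<Rightarrow> real^3" where
  "whitney_face T n v lam C f = (\<Sum>(i, j)\<in>face_boundary T n v f. whitney_mod T n v lam C i j)"

definition M1 ::
  "(real^3) set \<Rightarrow> nat \<Rightarrow> (nat \<Rightarrow> real^3) \<Rightarrow> (nat \<Rightarrow> real^3 \<Rightarrow> real) \<Rightarrow>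
   (nat \<Rightarrow> nat \<Rightarrow> nat \<Rightarrow> real) \<Rightarrow> (real^3 \<Rightarrow> real^3) set" where
  "M1 T n v lam C =
     {u + w | u w. u \<in> span ((\<lambda>i. grad_on T (lam i)) ` {1..n}) \<and>
                   w \<in> span (whitney_face T n v lam C ` faces T)}"

section \<open>The linear system behind computability\<close>

text \<open>One equation per edge \<open>e'\<close>, one unknown \<open>a i\<close> per vertex and \<open>b f\<close> per face. The coefficient of
  \<open>a i\<close> is the (constant) tangential component of \<open>\<nabla>\<lambda>\<^sub>i\<close> on \<open>e'\<close>, that of \<open>b f\<close> the tangential component
  of the field of the face \<open>f\<close>; both are written in terms of the incidence relations and the edge
  lengths only. The right-hand side is the unit vector of the edge \<open>e\<close>.\<close>

definition vertex_entry :: "(nat \<Rightarrow> real^3) \<Rightarrow> nat \<times> nat \<Rightarrow> nat \<Rightarrow> real" where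
  "vertex_entry v e' i =
     (if i = snd e' then 1 else if i = fst e' then -1 else 0) / norm (tau v (fst e') (snd e'))"

definition face_entry ::
  "(real^3) set \<Rightarrow> nat \<Rightarrow> (nat \<Rightarrow> real^3) \<Rightarrow> nat \<times> nat \<Rightarrow> (real^3) set \<Rightarrow> real" where
  "face_entry T n v e' f =
     (if e' \<in> face_boundary T n v f then 1
      else if (snd e', fst e') \<in> face_boundary T n v f then -1 else 0)
     / norm (tau v (fst e') (snd e'))"

definition solves_edge_system ::
  "(real^3) set \<Rightarrow> nat \<Rightarrow> (nat \<Rightarrow> real^3) \<Rightarrow> (nat \<times> nat) set \<Rightarrow> nat \<times> nat \<Rightarrow>
   (nat \<Rightarrow> real) \<Rightarrow> ((real^3) set \<Rightarrow> real) \<Rightarrow> bool" where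
  "solves_edge_system T n v Ep e a b \<longleftrightarrow>
     (\<forall>e'\<in>Ep. (\<Sum>i\<in>{1..n}. vertex_entry v e' i * a i) + (\<Sum>f\<in>faces T. face_entry T n v e' f * b f)
              = (if e = e' then 1 else 0))"

end

theory Submission
  imports Defs
begin

text \<open>On an edge the tangential component of \<open>\<nabla>\<lambda>\<^sub>i\<close> is the coboundary of the indicator of the vertex
  \<open>i\<close>, and that of the field of a face is the signed incidence of its boundary, because a Whitney
  form \<open>W\<^sub>i\<^sub>j\<close> is tangentially nonzero only on the edge \<open>e\<^sub>i\<^sub>j\<close> itself. After multiplication of each
  equation by the edge length, the linear system thus reads \<open>d a + \<partial> b = y\<close> on the surface of \<open>T\<close>. The ranges of
  \<open>d\<close> and \<open>\<partial>\<close> are orthogonal, and since the surface has no first cohomology they span all edge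
  functions, so the system is solvable. Its kernel consists of constant \<open>a\<close> and constant \<open>b\<close>, and
  these produce the zero field since \<open>\<Sum>\<^sub>i \<nabla>\<lambda>\<^sub>i = 0\<close> and the fields of all faces cancel along edges. The
  topology of the surface (connectedness, vanishing cohomology) is obtained by sweeping \<open>T\<close> with
  a generic linear function and pivoting along faces as in the simplex method.\<close>

section \<open>Polytopes\<close>

text \<open>Coefficients solving the edge system are never unique, so \<open>p e\<close> is not tied
  to a particular solution; what is unique is the field, since it is determined by its edge values.
  The obstacle is that the topology of the surface has to come from convexity. A height separating
  the vertices turns connectedness into a descent along edges, and exactness into a statement about
  the neighbours below the vertex being added; that statement is again a descent, with slopes in
  place of heights. Both rest on one pivot, \<open>polytope_descending_face\<close>, applied to a
  vertex in the first case and to an edge in the second. The incidence facts (one face on each side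
  of an edge, one incoming and one outgoing edge at a vertex of a face) come from signs of triple
  products with the outward normal and from counting facets at a face of codimension two.\<close>

lemma ex_generic_functional:
  fixes U :: "'a::euclidean_space set"
  assumes "finite W" "0 \<notin> W" "open U" "U \<noteq> {}"
  shows "\<exists>k\<in>U. \<forall>w\<in>W. k \<bullet> w \<noteq> 0"
  using assms
proof (induction W arbitrary: U rule: finite_induct)
  case empty
  then show ?case by auto
next
  case (insert w W)
  let ?U = "U \<inter> {k. k \<bullet> w \<noteq> 0}"
  have op: "open ?U"
    using insert.prems(2) by (intro open_Int open_Collect_neq continuous_intros) auto
  obtain k where k: "k \<in> U" using insert.prems by auto
  have "?U \<noteq> {}"
  proof (cases "k \<bullet> w = 0")
    case False
    then show ?thesis using k by auto
  next
    case True
    obtain e where e: "e > 0" "ball k e \<subseteq> U"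
      using insert.prems(2) k by (meson open_contains_ball)
    have w: "w \<noteq> 0" using insert.prems by auto
    \<comment> \<open>A shift along w by half the radius stays in the ball and changes the product
      with w by a nonzero amount.\<close>
    let ?k = "k + (e / (2 * norm w)) *\<^sub>R w"
    have "?k \<in> ball k e" using e w by (simp add: dist_norm)
    moreover have "?k \<bullet> w \<noteq> 0" using True e w by (simp add: inner_add_left)
    ultimately show ?thesis using e by blast
  qed
  from insert.IH[OF _ op this] insert.prems show ?case by auto
qed

text \<open>Of three distinct collinear points one lies strictly between the others. For vertices of
  T this rules out parallel directions from a common vertex.\<close>

lemma extreme_points_not_collinear:
  fixes a b c :: "'a::euclidean_space"
  assumes "a extreme_point_of S" "b extreme_point_of S" "c extreme_point_of S"
    and "a \<noteq> b" "a \<noteq> c" "b \<noteq> c"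
  shows "\<not> collinear {a, b, c}"
proof
  assume "collinear {a, b, c}"
  then have "a \<in> open_segment b c \<or> b \<in> open_segment c a \<or> c \<in> open_segment a b"
    using assms by (auto simp: collinear_between_cases between_mem_segment open_segment_def)
  then show False
    using assms(1-3) by (auto simp: extreme_point_of_def)
qed

text \<open>One pivot of the shadow vertex method: tilt \<open>c\<close> by the functional exposing \<open>F\<close>
  just enough to become minimal on \<open>F\<close>.\<close>

lemma polytope_descending_face:
  fixes T :: "'a::euclidean_space set"
  assumes T: "polytope T" and F: "F face_of T"
    and cF: "\<And>x. x \<in> F \<Longrightarrow> c \<bullet> x = d" and y: "y \<in> T" "c \<bullet> y < d"
  obtains G where "G face_of T" "F \<subset> G" "\<And>x. x \<in> G - F \<Longrightarrow> c \<bullet> x < d"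
proof -
  let ?V = "{x. x extreme_point_of T}"
  have fV: "finite ?V"
    using T by (simp add: finite_polyhedron_extreme_points polytope_imp_polyhedron)
  have hull: "T = convex hull ?V"
    using T by (simp add: Krein_Milman_Minkowski polytope_imp_compact polytope_imp_convex)
  have VT: "?V \<subseteq> T" by (auto simp: extreme_point_of_def)
  have "F exposed_face_of T"
    using F T by (simp add: exposed_face_of_polyhedron polytope_imp_polyhedron)
  then obtain a b where ab: "T \<subseteq> {x. a \<bullet> x \<le> b}" "F = T \<inter> {x. a \<bullet> x = b}"
    unfolding exposed_face_of_def by blast
  have pos: "b - a \<bullet> u > 0" if "u \<in> ?V - F" for u
    using that ab VT by fastforce
  obtain w where w: "w \<in> ?V" "c \<bullet> w < d"
  proof (rule ccontr)
    assume "\<not> thesis"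
    then have "?V \<subseteq> {x. c \<bullet> x \<ge> d}" using that by force
    then have "T \<subseteq> {x. c \<bullet> x \<ge> d}"
      by (subst hull, intro hull_minimal convex_halfspace_ge)
    then show False using y by auto
  qed
  have wF: "w \<in> ?V - F" using w cF by force
  \<comment> \<open>At t = \<open>r u\<close> the tilted functional \<open>c - t *\<^sub>R a\<close>
    takes at the vertex u the same value as on F. The maximum is the least tilt that leaves no
    vertex below this value, and it is attained at a vertex off F.\<close>
  define r where "r u = (d - c \<bullet> u) / (b - a \<bullet> u)" for u
  define t where "t = Max (r ` (?V - F))"
  have fin: "finite (r ` (?V - F))" using fV by auto
  have rt: "r u \<le> t" if "u \<in> ?V - F" for u
    unfolding t_def using fin that by (intro Max_ge) auto
  have "t \<in> r ` (?V - F)"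
    unfolding t_def using fin wF by (intro Max_in) auto
  then obtain m where m: "m \<in> ?V - F" "t = r m" by auto
  have "0 < r w" unfolding r_def using w(2) pos[OF wF] by simp
  then have t: "t > 0" using rt[OF wF] by simp
  let ?c = "c - t *\<^sub>R a" and ?d = "d - t * b"
  have ge: "?c \<bullet> u \<ge> ?d" if "u \<in> ?V" for u
  proof (cases "u \<in> F")
    case True
    then show ?thesis using cF ab by (simp add: inner_diff_left)
  next
    case False
    then have u: "u \<in> ?V - F" using that by auto
    then have "d - c \<bullet> u \<le> t * (b - a \<bullet> u)"
      using rt[OF u] pos[OF u] by (simp add: r_def divide_simps split: if_splits)
    then show ?thesis by (simp add: inner_diff_left algebra_simps)
  qed
  have geT: "?c \<bullet> x \<ge> ?d" if "x \<in> T" for x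
  proof -
    have "T \<subseteq> {x. ?c \<bullet> x \<ge> ?d}"
      by (subst hull, intro hull_minimal convex_halfspace_ge) (use ge in auto)
    then show ?thesis using that by auto
  qed
  let ?G = "T \<inter> {x. ?c \<bullet> x = ?d}"
  have "?G face_of T"
    using geT T by (intro face_of_Int_supporting_hyperplane_ge polytope_imp_convex)
  moreover have "F \<subseteq> ?G"
    using cF ab by (auto simp: inner_diff_left)
  moreover have "m \<in> ?G"
    using m pos[OF m(1)] VT by (auto simp: r_def inner_diff_left field_simps)
  \<comment> \<open>On G, c falls short of d by t times the slack \<open>b - a \<bullet> x\<close>,
    which is positive off F; t is positive because some vertex lies below level d.\<close>
  moreover have "c \<bullet> x < d" if "x \<in> ?G - F" for x
  proof -
    have "a \<bullet> x < b" using that ab by fastforce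
    then have "t * (a \<bullet> x) < t * b" using t by simp
    then show ?thesis using that by (simp add: inner_diff_left)
  qed
  ultimately show thesis using m(1) that[of ?G] by blast
qed

text \<open>Passing to a facet through w lowers the dimension and keeps w extreme, down to dimension
  1; edges of a facet are again edges of G.\<close>

lemma polytope_edge_at_vertex:
  fixes G :: "'a::euclidean_space set"
  assumes "polytope G" "w extreme_point_of G" "G \<noteq> {w}"
  shows "\<exists>e. e edge_of G \<and> w \<in> e"
  using assms
proof (induction "nat (aff_dim G)" arbitrary: G rule: less_induct)
  case less
  have w: "{w} face_of G" using less.prems by (simp add: face_of_singleton)
  have "aff_dim {w} < aff_dim G"
    using w less.prems by (intro face_of_aff_dim_lt polytope_imp_convex) auto
  then have pos: "aff_dim G \<ge> 1" by simp
  show ?case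
  proof (cases "aff_dim G = 1")
    case True
    then have "G edge_of G"
      using less.prems by (simp add: edge_of_def face_of_refl polytope_imp_convex)
    then show ?thesis using w by (auto dest: face_of_imp_subset)
  next
    case False
    obtain F where F: "F facet_of G" "{w} \<subseteq> F"
      using face_of_polyhedron_subset_facet[OF _ w] less.prems polytope_imp_polyhedron by blast
    then have d: "aff_dim F = aff_dim G - 1" and FG: "F face_of G"
      by (auto simp: facet_of_def)
    have "w extreme_point_of F"
      using F FG less.prems by (simp add: extreme_point_of_face)
    moreover have "F \<noteq> {w}" using d pos False by auto
    moreover have "polytope F" using FG less.prems face_of_polytope_polytope by blast
    ultimately obtain e where "e edge_of F" "w \<in> e"
      using less.hyps[of F] d pos by auto
    then show ?thesis
      using FG by (metis edge_of_def face_of_trans)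
  qed
qed

text \<open>F is the intersection of the facets containing it, and a single facet has too large a
  dimension. Applied to a vertex of a polygon and to an edge of T.\<close>

lemma polytope_two_facets_at_face:
  fixes G :: "'a::euclidean_space set"
  assumes "polytope G" "F face_of G" "F \<noteq> {}" "aff_dim F = aff_dim G - 2"
  obtains f g where "f facet_of G" "g facet_of G" "F \<subseteq> f" "F \<subseteq> g" "f \<noteq> g"
proof -
  have ph: "polyhedron G" using assms polytope_imp_polyhedron by blast
  have ne: "F \<noteq> G" using assms(4) by auto
  obtain f where f: "f facet_of G" "F \<subseteq> f"
    using face_of_polyhedron_subset_facet[OF ph assms(2,3) ne] by blast
  have "F = \<Inter>{f. f facet_of G \<and> F \<subseteq> f}"
    using face_of_polyhedron[OF ph assms(2,3) ne] .
  moreover have "F \<noteq> f" using f assms(4) by (auto simp: facet_of_def)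
  ultimately have "{f. f facet_of G \<and> F \<subseteq> f} \<noteq> {f}" by auto
  then show thesis using f that by blast
qed

lemma edge_eq_closed_segment:
  fixes e :: "'a::euclidean_space set"
  assumes "e edge_of T" "polytope T"
  obtains a b where "a \<noteq> b" "e = closed_segment a b" "a extreme_point_of T" "b extreme_point_of T"
proof -
  have e: "e face_of T" "aff_dim e = 1" using assms by (auto simp: edge_of_def)
  have "polytope e" using e assms face_of_polytope_polytope by blast
  then obtain a b where ab: "e = closed_segment a b"
    using compact_convex_collinear_segment[of e] e
    by (metis aff_dim_empty collinear_aff_dim linorder_not_le one_neq_neg_one order_refl polytope_imp_compact polytope_imp_convex)
  moreover have "a \<noteq> b" using ab e by auto
  ultimately show thesis
    using that extreme_point_of_face[OF e(1)] extreme_point_of_segment by metis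
qed

section \<open>Faces, edges and orientation\<close>

text \<open>Both vectors lie in the plane orthogonal to u, so their product is a multiple of u. This
  turns a vanishing sign test against the outward normal into collinearity.\<close>

lemma cross3_eq_0_of_perp:
  fixes u a b :: "real^3"
  assumes "u \<bullet> a = 0" "u \<bullet> b = 0" "cross3 a b \<bullet> u = 0" "norm u = 1"
  shows "cross3 a b = 0"
proof (rule cross_dot_cancel[of u])
  show "cross3 u (cross3 a b) = cross3 u 0" using assms by (simp add: Lagrange)
  show "u \<bullet> cross3 a b = u \<bullet> 0" using assms by (simp add: inner_commute)
  show "u \<noteq> 0" using assms by auto
qed

lemma cross3_zero_imp_collinear:
  fixes a b c :: "real^3"
  assumes "cross3 (b - a) (c - a) = 0"
  shows "collinear {a, b, c}"
proof -
  have "collinear {0, b - a, c - a}" using assms unfolding cross_eq_0 .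
  then have "collinear {b, a, c}" by (subst collinear_3) (simp_all add: NO_MATCH_def)
  then show ?thesis by (simp add: insert_commute)
qed

lemma parallel_unit_normals:
  fixes u w a b :: "real^3"
  assumes "norm u = 1" "norm w = 1" "cross3 a b \<noteq> 0"
    and "u \<bullet> a = 0" "u \<bullet> b = 0" "w \<bullet> a = 0" "w \<bullet> b = 0"
  shows "w = u \<or> w = - u"
proof -
  have par: "\<exists>r. u = r *\<^sub>R cross3 a b" if "u \<bullet> a = 0" "u \<bullet> b = 0" for u
  proof -
    have "cross3 u (cross3 a b) = 0" using that by (simp add: Lagrange)
    then have "collinear {0, cross3 a b, u}" by (metis cross_eq_0 insert_commute)
    then show ?thesis using assms(3) by (auto simp: collinear_lemma)
  qed
  obtain r s where rs: "u = r *\<^sub>R cross3 a b" "w = s *\<^sub>R cross3 a b"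
    using par assms by metis
  then have "\<bar>r\<bar> * norm (cross3 a b) = \<bar>s\<bar> * norm (cross3 a b)"
    using assms by simp
  then have "\<bar>r\<bar> = \<bar>s\<bar>" using assms by simp
  then show ?thesis using rs by (auto simp: abs_if split: if_splits)
qed

text \<open>Expansion of p in the orthogonal frame t, \<open>cross3 u t\<close> of the plane
  orthogonal to u. The sign of the coefficient of the conormal \<open>cross3 u t\<close> tells on
  which side of the line along t the vector p points.\<close>

lemma cross3_plane_expand:
  fixes u p t :: "real^3"
  assumes "u \<bullet> t = 0" "u \<bullet> p = 0" "norm u = 1"
  shows "(t \<bullet> t) *\<^sub>R p = (cross3 t p \<bullet> u) *\<^sub>R cross3 u t + (t \<bullet> p) *\<^sub>R t"
proof -
  have c: "cross3 t p = (cross3 t p \<bullet> u) *\<^sub>R u"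
  proof (rule cross_dot_cancel[of u])
    show "cross3 u (cross3 t p) = cross3 u ((cross3 t p \<bullet> u) *\<^sub>R u)"
      using assms by (simp add: Lagrange cross_mult_right)
    show "u \<bullet> cross3 t p = u \<bullet> (cross3 t p \<bullet> u) *\<^sub>R u"
      using assms by (simp add: inner_commute norm_eq_1)
    show "u \<noteq> 0" using assms by auto
  qed
  have "cross3 (cross3 t p) t = (t \<bullet> t) *\<^sub>R p - (t \<bullet> p) *\<^sub>R t"
    by (subst cross_skew) (simp add: Lagrange)
  moreover have "cross3 (cross3 t p) t = (cross3 t p \<bullet> u) *\<^sub>R cross3 u t"
    by (subst c) (rule cross_mult_left)
  ultimately show ?thesis by (simp add: algebra_simps)
qed

section \<open>Vertices, faces and outward normals\<close>

locale polyhedron3 =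
  fixes T :: "(real^3) set" and n :: nat and v :: "nat \<Rightarrow> real^3"
  assumes poly: "convex_polyhedron T n v"
begin

abbreviation "E \<equiv> edges T n v"
abbreviation "bd \<equiv> face_boundary T n v"
abbreviation "normal \<equiv> outward_normal T"

lemma polytope_T: "polytope T" and convex_T: "convex T" and polyhedron_T: "polyhedron T"
  using poly by (auto simp: convex_polyhedron_def polytope_imp_convex polytope_imp_polyhedron)

lemma aff_dim_T: "aff_dim T = 3"
  using poly by (simp add: convex_polyhedron_def aff_dim_nonempty_interior)

lemma vertex_extreme: "i \<in> {1..n} \<Longrightarrow> v i extreme_point_of T"
  using poly by (auto simp: convex_polyhedron_def bij_betw_def)

lemma vertex_in_T: "i \<in> {1..n} \<Longrightarrow> v i \<in> T"
  using vertex_extreme by (auto simp: extreme_point_of_def)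

lemma vertex_index: "x extreme_point_of T \<Longrightarrow> \<exists>i\<in>{1..n}. v i = x"
proof -
  have "v ` {1..n} = {x. x extreme_point_of T}"
    using poly by (simp add: convex_polyhedron_def bij_betw_def)
  moreover assume "x extreme_point_of T"
  ultimately have "x \<in> v ` {1..n}" by simp
  then show "\<exists>i\<in>{1..n}. v i = x" by (auto simp del: atLeastAtMost_iff)
qed

lemma inj_vertex: "i \<in> {1..n} \<Longrightarrow> j \<in> {1..n} \<Longrightarrow> v i = v j \<longleftrightarrow> i = j"
  using poly unfolding convex_polyhedron_def by (meson bij_betw_imp_inj_on inj_on_eq_iff)

lemma not_in_plane:
  assumes "u \<noteq> 0"
  shows "\<exists>y\<in>T. u \<bullet> (y - x) \<noteq> 0"
proof (rule ccontr)
  assume "\<not> ?thesis"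
  then have "T \<subseteq> {y. u \<bullet> y = u \<bullet> x}" by (auto simp: inner_diff_right)
  then have "aff_dim T \<le> aff_dim {y. u \<bullet> y = u \<bullet> x}" by (rule aff_dim_subset)
  then show False using aff_dim_T assms by simp
qed

lemma faceD:
  assumes "f \<in> faces T"
  shows "f face_of T" "aff_dim f = 2" "polytope f" "convex f" "f \<subseteq> T" "f \<noteq> {}"
  using assms aff_dim_T polytope_T face_of_polytope_polytope[of T f]
  by (auto simp: faces_def facet_of_def face_of_imp_convex dest: face_of_imp_subset)

lemma finite_faces: "finite (faces T)"
  using finite_polytope_facets[OF polytope_T] by (simp add: faces_def)

lemma face_not_collinear:
  assumes "f \<in> faces T"
  shows "\<exists>p\<in>f. \<exists>q\<in>f. \<exists>r\<in>f. cross3 (q - p) (r - p) \<noteq> 0"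
proof (rule ccontr)
  assume neg: "\<not> ?thesis"
  have nc: "\<not> collinear f" using faceD(2)[OF assms] by (simp add: collinear_aff_dim)
  obtain p where "p \<in> f" using faceD(6)[OF assms] by blast
  moreover have "f \<noteq> {p}" using faceD(2)[OF assms] by auto
  ultimately obtain q where pq: "p \<in> f" "q \<in> f" "p \<noteq> q" by blast
  have "collinear {p, q, r}" if "r \<in> f" for r
    by (rule cross3_zero_imp_collinear) (use neg pq(1,2) that in blast)
  then have "collinear (insert p (insert q f))"
    using collinear_triples[OF pq(3), of f] by blast
  moreover have "insert p (insert q f) = f" using pq by blast
  ultimately show False using nc by simp
qed

text \<open>The plane of f fixes a unit normal up to sign, and if both signs were outward, T would
  lie in that plane.\<close>

lemma outward_normal_unique:
  assumes f: "f \<in> faces T" and "norm u = 1" "norm w = 1"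
    and u: "\<forall>x\<in>f. \<forall>y\<in>f. u \<bullet> (y - x) = 0" "\<forall>x\<in>f. \<forall>y\<in>T. u \<bullet> (y - x) \<le> 0"
    and w: "\<forall>x\<in>f. \<forall>y\<in>f. w \<bullet> (y - x) = 0" "\<forall>x\<in>f. \<forall>y\<in>T. w \<bullet> (y - x) \<le> 0"
  shows "w = u"
proof (rule ccontr)
  assume "w \<noteq> u"
  obtain p q r where pqr: "p \<in> f" "q \<in> f" "r \<in> f" "cross3 (q - p) (r - p) \<noteq> 0"
    using face_not_collinear[OF f] by blast
  have "w = u \<or> w = - u"
    by (rule parallel_unit_normals[OF assms(2,3) pqr(4)]) (use u(1) w(1) pqr in auto)
  then have "w = - u" using \<open>w \<noteq> u\<close> by simp
  then have "\<forall>y\<in>T. u \<bullet> (y - p) = 0"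
    using u(2) w(2) pqr(1) by (metis inner_minus_left neg_le_0_iff_le order_antisym)
  then show False using not_in_plane[of u p] assms(2) by force
qed

text \<open>A facet is exposed, and its normalized exposing functional is the outward normal. The
  last property says that f is the whole contact set of T with its supporting plane, so faces with
  the same normal and a common point coincide.\<close>

lemma face_normal:
  assumes f: "f \<in> faces T"
  shows "norm (normal f) = 1"
    and "x \<in> f \<Longrightarrow> y \<in> f \<Longrightarrow> normal f \<bullet> (y - x) = 0"
    and "x \<in> f \<Longrightarrow> y \<in> T \<Longrightarrow> normal f \<bullet> (y - x) \<le> 0"
    and "x \<in> f \<Longrightarrow> y \<in> T \<Longrightarrow> normal f \<bullet> (y - x) = 0 \<Longrightarrow> y \<in> f"
proof -
  have "f exposed_face_of T"
    using faceD[OF f] by (simp add: exposed_face_of_polyhedron polyhedron_T)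
  then obtain a b where ab: "T \<subseteq> {x. a \<bullet> x \<le> b}" "f = T \<inter> {x. a \<bullet> x = b}"
    unfolding exposed_face_of_def by blast
  have "a \<noteq> 0"
  proof
    assume "a = 0"
    then have "f = T" using ab faceD(6)[OF f] by auto
    then show False using faceD(2)[OF f] aff_dim_T by simp
  qed
  define u where "u = a /\<^sub>R norm a"
  have nu: "norm u = 1" using \<open>a \<noteq> 0\<close> by (simp add: u_def)
  have ip: "u \<bullet> (y - x) = (a \<bullet> y - a \<bullet> x) / norm a" for x y
    by (simp add: u_def inner_diff_right divide_inverse mult.commute right_diff_distrib)
  have 2: "\<forall>x\<in>f. \<forall>y\<in>f. u \<bullet> (y - x) = 0" using ab(2) by (auto simp: ip)
  have 3: "\<forall>x\<in>f. \<forall>y\<in>T. u \<bullet> (y - x) \<le> 0"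
    using ab \<open>a \<noteq> 0\<close> by (auto simp: ip divide_le_0_iff)
  have eq: "normal f = u"
    unfolding outward_normal_def
  proof (rule the_equality, intro conjI)
    fix w
    assume "norm w = 1 \<and> (\<forall>x\<in>f. \<forall>y\<in>f. w \<bullet> (y - x) = 0) \<and> (\<forall>x\<in>f. \<forall>y\<in>T. w \<bullet> (y - x) \<le> 0)"
    then show "w = u" using outward_normal_unique[OF f nu _ 2 3, of w] by blast
  qed (rule nu 2 3)+
  show "norm (normal f) = 1" using nu eq by simp
  show "x \<in> f \<Longrightarrow> y \<in> f \<Longrightarrow> normal f \<bullet> (y - x) = 0" using 2 eq by simp
  show "x \<in> f \<Longrightarrow> y \<in> T \<Longrightarrow> normal f \<bullet> (y - x) \<le> 0" using 3 eq by simp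
  show "y \<in> f" if "x \<in> f" "y \<in> T" "normal f \<bullet> (y - x) = 0"
  proof -
    have "a \<bullet> y = a \<bullet> x" using that(3) \<open>a \<noteq> 0\<close> unfolding eq ip by simp
    then show ?thesis using that(1,2) unfolding ab(2) by simp
  qed
qed

section \<open>Directed edges and oriented face boundaries\<close>

lemma edges_iff: "(i, j) \<in> E \<longleftrightarrow> i \<in> {1..n} \<and> j \<in> {1..n} \<and> i \<noteq> j \<and> seg v (i, j) edge_of T"
  by (auto simp: edges_def directed_segs_def)

lemma seg_commute: "seg v (i, j) = seg v (j, i)"
  by (simp add: seg_def closed_segment_commute)

lemma edges_commute: "(i, j) \<in> E \<longleftrightarrow> (j, i) \<in> E"
  by (auto simp: edges_iff seg_commute)

lemma finite_edges: "finite E"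
  by (rule finite_subset[of _ "{1..n} \<times> {1..n}"]) (auto simp: edges_def directed_segs_def)

lemma edge_of_face: "e edge_of f \<Longrightarrow> f face_of T \<Longrightarrow> e edge_of T"
  by (metis edge_of_def face_of_trans)

lemma bd_subset_edges: "f \<in> faces T \<Longrightarrow> bd f \<subseteq> E"
  using edge_of_face[OF _ faceD(1)] by (auto simp: face_boundary_def edges_def)

lemma edge_ex_seg:
  assumes "e edge_of T"
  shows "\<exists>i j. (i, j) \<in> E \<and> e = seg v (i, j)"
proof -
  obtain a b where ab: "a \<noteq> b" "e = closed_segment a b" "a extreme_point_of T" "b extreme_point_of T"
    using edge_eq_closed_segment[OF assms polytope_T] .
  obtain i j where ij: "i \<in> {1..n}" "j \<in> {1..n}" "v i = a" "v j = b"
    using ab vertex_index by meson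
  then have "e = seg v (i, j)" using ab by (simp add: seg_def)
  moreover have "i \<noteq> j" using ab(1) ij by auto
  ultimately show ?thesis using ij assms unfolding edges_iff by blast
qed

lemma seg_eq_iff:
  assumes "i \<in> {1..n}" "j \<in> {1..n}" "k \<in> {1..n}" "l \<in> {1..n}"
  shows "seg v (i, j) = seg v (k, l) \<longleftrightarrow> i = k \<and> j = l \<or> i = l \<and> j = k"
  using assms by (simp add: seg_def closed_segment_eq doubleton_eq_iff inj_vertex)

lemma vertex_in_seg:
  assumes "(i, j) \<in> E" "k \<in> {1..n}" "v k \<in> seg v (i, j)"
  shows "k = i \<or> k = j"
proof -
  have "seg v (i, j) face_of T" using assms by (simp add: edges_iff edge_of_def)
  then have "v k extreme_point_of seg v (i, j)"
    using assms vertex_extreme by (simp add: extreme_point_of_face)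
  then show ?thesis
    using assms inj_vertex by (auto simp: seg_def extreme_point_of_segment edges_iff)
qed

lemma edge_at_vertex:
  assumes "e edge_of T" "v i \<in> e" "i \<in> {1..n}"
  obtains j where "(i, j) \<in> E" "e = seg v (i, j)"
proof -
  obtain k l where kl: "(k, l) \<in> E" "e = seg v (k, l)" using edge_ex_seg[OF assms(1)] by blast
  then have "i = k \<or> i = l" using vertex_in_seg assms by auto
  then show thesis using that kl edges_commute seg_commute by metis
qed

lemma ends_in_seg: "v i \<in> seg v (i, k)" "v k \<in> seg v (i, k)"
  by (auto simp: seg_def)

lemma bdD:
  assumes "(i, j) \<in> bd f"
  shows "seg v (i, j) edge_of f" "i \<in> {1..n}" "j \<in> {1..n}" "i \<noteq> j" "v i \<in> f" "v j \<in> f"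
    "x \<in> f \<Longrightarrow> 0 \<le> cross3 (tau v i j) (x - v i) \<bullet> normal f"
  using assms ends_in_seg[where i = i and k = j]
  by (auto simp: face_boundary_def directed_segs_def dest: edge_of_imp_subset)

text \<open>A zero of the side function is collinear with the edge, and a convex set meets the
  affine hull of one of its faces only in that face.\<close>

lemma face_line:
  assumes f: "f \<in> faces T" and ij: "i \<noteq> j" "i \<in> {1..n}" "j \<in> {1..n}" "seg v (i, j) edge_of f"
    and x: "x \<in> f" "cross3 (tau v i j) (x - v i) \<bullet> normal f = 0"
  shows "x \<in> seg v (i, j)"
proof -
  have face: "seg v (i, j) face_of f" using ij by (simp add: edge_of_def)
  then have in_f: "v i \<in> f" "v j \<in> f" using ends_in_seg[where i = i and k = j] face_of_imp_subset by blast+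
  have "cross3 (v j - v i) (x - v i) = 0"
    using x(2) face_normal(2)[OF f in_f] face_normal(2)[OF f in_f(1) x(1)] face_normal(1)[OF f]
    by (intro cross3_eq_0_of_perp[of "normal f"]) (simp_all add: tau_def)
  then have "collinear {v i, v j, x}" by (rule cross3_zero_imp_collinear)
  moreover have "v i \<noteq> v j" using ij inj_vertex by simp
  ultimately have "x \<in> affine hull (seg v (i, j))"
    by (simp add: seg_def collinear_3_affine_hull)
  then show ?thesis
    using face_of_imp_eq_affine_Int[OF faceD(4)[OF f] face] x by blast
qed

lemma cross3_tau_rev:
  "cross3 (tau v j i) (x - v j) = - cross3 (tau v i j) (x - v i)"
proof -
  have "cross3 (tau v j i) (x - v j) = - cross3 (tau v i j) (x - v i - tau v i j)"
    by (simp add: tau_def flip: cross_minus_left)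
  then show ?thesis by (simp add: Cross3.right_diff_distrib)
qed

text \<open>If the side function changed sign on f, some segment in f would meet the edge at an
  interior point of the segment; as the edge is a face of f, it would contain the ends of that
  segment, where the side function is nonzero.\<close>

lemma edge_oriented:
  assumes f: "f \<in> faces T" and ij: "i \<noteq> j" "i \<in> {1..n}" "j \<in> {1..n}" "seg v (i, j) edge_of f"
  shows "(i, j) \<in> bd f \<or> (j, i) \<in> bd f"
proof (rule ccontr)
  let ?h = "\<lambda>x. cross3 (tau v i j) (x - v i) \<bullet> normal f"
  assume "\<not> ?thesis"
  then obtain x y where xy: "x \<in> f" "?h x < 0" "y \<in> f" "?h y > 0"
    using ij by (force simp: face_boundary_def directed_segs_def seg_commute[of j i] cross3_tau_rev[of j i])
  \<comment> \<open>Position of the zero of the affine function \<open>?h\<close> on the segment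
    from x to y.\<close>
  define t where "t = - ?h x / (?h y - ?h x)"
  define z where "z = (1 - t) *\<^sub>R x + t *\<^sub>R y"
  have t: "0 < t" "t < 1" using xy by (auto simp: t_def field_simps)
  have "x \<noteq> y" using xy by auto
  then have zs: "z \<in> open_segment x y" using t by (auto simp: in_segment z_def)
  have "z - v i = (1 - t) *\<^sub>R (x - v i) + t *\<^sub>R (y - v i)"
    by (simp add: z_def algebra_simps)
  then have "?h z = (1 - t) * ?h x + t * ?h y"
    by (simp add: cross_add_right cross_mult_right inner_add_left)
  also have "\<dots> = ?h x + t * (?h y - ?h x)" by (simp add: algebra_simps)
  also have "\<dots> = 0" using xy by (simp add: t_def)
  finally have "?h z = 0" .
  moreover have "z \<in> f"
    using zs xy faceD(4)[OF f] convex_contains_open_segment by blast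
  ultimately have "z \<in> seg v (i, j)" using face_line[OF f ij] by blast
  then have "x \<in> seg v (i, j)"
    using zs xy ij(4) unfolding edge_of_def face_of_def by blast
  then have "collinear {v i, v j, x}"
    by (metis collinear_3_affine_hull affine_hull_closed_segment hull_inc ij(1-3) inj_vertex seg_def fst_conv snd_conv)
  then have "collinear {0, v j - v i, x - v i}"
    by (subst (asm) insert_commute, subst (asm) collinear_3) (simp_all add: NO_MATCH_def)
  then have "?h x = 0" by (simp add: tau_def flip: cross_eq_0)
  then show False using xy by simp
qed

text \<open>The sign condition in \<open>face_boundary\<close> is not strict, but f is larger than
  its edge. The strict point is what determines the direction of the edge and the face to its
  left.\<close>

lemma bd_strict:
  assumes "f \<in> faces T" "(i, j) \<in> bd f"
  shows "\<exists>x\<in>f. 0 < cross3 (tau v i j) (x - v i) \<bullet> normal f"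
proof -
  have "seg v (i, j) \<noteq> f" using faceD(2)[OF assms(1)] bdD(1)[OF assms(2)] by (auto simp: edge_of_def)
  then obtain x where x: "x \<in> f" "x \<notin> seg v (i, j)"
    using edge_of_imp_subset[OF bdD(1)[OF assms(2)]] by blast
  then show ?thesis
    using face_line[OF assms(1) bdD(4,2,3,1)[OF assms(2)]] bdD(7)[OF assms(2)]
    by (metis order_less_le)
qed

lemma bd_asym:
  assumes "f \<in> faces T" "(i, j) \<in> bd f"
  shows "(j, i) \<notin> bd f"
proof
  assume ji: "(j, i) \<in> bd f"
  obtain x where "x \<in> f" "0 < cross3 (tau v i j) (x - v i) \<bullet> normal f"
    using bd_strict[OF assms] by blast
  then show False using bdD(7)[OF ji, of x] by (simp add: cross3_tau_rev[of j i])
qed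

text \<open>Two faces on the left of the same directed edge would have conormals turned into
  each other's outer half-space.\<close>

lemma bd_face_unique:
  assumes f: "f \<in> faces T" "(i, j) \<in> bd f" and g: "g \<in> faces T" "(i, j) \<in> bd g"
  shows "f = g"
proof -
  let ?t = "tau v i j"
  have perp: "normal h \<bullet> ?t = 0" if "h \<in> faces T" "(i, j) \<in> bd h" for h
    using face_normal(2)[OF that(1)] bdD(5,6)[OF that(2)] by (simp add: tau_def)
  have t: "?t \<bullet> ?t > 0" using bdD[OF f(2)] inj_vertex by (simp add: tau_def)
  \<comment> \<open>\<open>cross3 (normal h) ?t\<close> points from the edge into h: up to a
    positive factor and a multiple of \<open>?t\<close> it is the direction to a point of h. There
    the normal of k is non-positive, and it is orthogonal to \<open>?t\<close>.\<close>
  have half: "normal k \<bullet> cross3 (normal h) ?t \<le> 0"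
    if h: "h \<in> faces T" "(i, j) \<in> bd h" and k: "k \<in> faces T" "(i, j) \<in> bd k" for h k
  proof -
    obtain x where x: "x \<in> h" "0 < cross3 ?t (x - v i) \<bullet> normal h"
      using bd_strict[OF h] by blast
    let ?p = "x - v i"
    have "(?t \<bullet> ?t) * (normal k \<bullet> ?p) = normal k \<bullet> (?t \<bullet> ?t) *\<^sub>R ?p" by simp
    also have "\<dots> = (cross3 ?t ?p \<bullet> normal h) * (normal k \<bullet> cross3 (normal h) ?t)"
      using perp[OF h] perp[OF k] face_normal(1,2)[OF h(1)] x(1) bdD(5)[OF h(2)]
      by (subst cross3_plane_expand[of "normal h"]) (auto simp: inner_add_right)
    finally have eq: "(?t \<bullet> ?t) * (normal k \<bullet> ?p) = \<dots>" .
    have "normal k \<bullet> ?p \<le> 0"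
      using face_normal(3)[OF k(1) bdD(5)[OF k(2)]] x(1) faceD(5)[OF h(1)] by blast
    then have "(cross3 ?t ?p \<bullet> normal h) * (normal k \<bullet> cross3 (normal h) ?t) \<le> 0"
      using t unfolding eq[symmetric] by (simp add: mult_le_0_iff)
    then show ?thesis using x(2) by (simp add: mult_le_0_iff)
  qed
  \<comment> \<open>The triple product changes sign when f and g are exchanged, so the two
    inequalities force it to vanish.\<close>
  have "normal g \<bullet> cross3 (normal f) ?t = - (normal f \<bullet> cross3 (normal g) ?t)"
    by (metis cross_skew cross_triple inner_commute inner_minus_right)
  then have z: "normal g \<bullet> cross3 (normal f) ?t = 0"
    using half[OF f g] half[OF g f] by simp
  have "cross3 ?t (cross3 (normal f) ?t) = (?t \<bullet> ?t) *\<^sub>R normal f"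
    using perp[OF f] by (simp add: Lagrange inner_commute)
  then have "cross3 ?t (cross3 (normal f) ?t) \<noteq> 0"
    using t face_normal(1)[OF f(1)] by auto
  then have "normal g = normal f \<or> normal g = - normal f"
    using parallel_unit_normals[of "normal f" "normal g" ?t "cross3 (normal f) ?t"]
      face_normal(1) f(1) g(1) perp[OF f] perp[OF g] z by (simp add: dot_cross_self)
  moreover have "normal g \<noteq> - normal f"
  proof
    assume neg: "normal g = - normal f"
    have "normal f \<bullet> (y - v i) = 0" if "y \<in> T" for y
      using face_normal(3)[OF f(1) bdD(5)[OF f(2)] that] face_normal(3)[OF g(1) bdD(5)[OF g(2)] that]
      by (simp add: neg)
    then show False using not_in_plane[of "normal f" "v i"] face_normal(1)[OF f(1)] by force
  qed
  ultimately have "normal g = normal f" by blast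
  then have "x \<in> f \<longleftrightarrow> x \<in> g" for x
    using face_normal(2,4)[OF f(1) bdD(5)[OF f(2)], of x]
      face_normal(2,4)[OF g(1) bdD(5)[OF g(2)], of x] faceD(5)[OF f(1)] faceD(5)[OF g(1)]
    by auto
  then show ?thesis by blast
qed

text \<open>The edge lies in two facets, each having it on its boundary in one of the two
  directions; the same direction in both is impossible, so each direction has its face.\<close>

lemma edge_has_left_face:
  assumes "(i, j) \<in> E"
  shows "\<exists>f\<in>faces T. (i, j) \<in> bd f"
proof -
  have e: "seg v (i, j) face_of T" "aff_dim (seg v (i, j)) = 1"
    using assms by (auto simp: edges_iff edge_of_def)
  have "seg v (i, j) \<noteq> {}" "aff_dim (seg v (i, j)) = aff_dim T - 2"
    using ends_in_seg[where i = i and k = j] e(2) aff_dim_T by auto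
  then obtain f g where fg: "f facet_of T" "g facet_of T" "seg v (i, j) \<subseteq> f" "seg v (i, j) \<subseteq> g" "f \<noteq> g"
    using polytope_two_facets_at_face[OF polytope_T e(1)] by metis
  then have mem: "f \<in> faces T" "g \<in> faces T" by (auto simp: faces_def)
  have "seg v (i, j) edge_of h" if "h \<in> faces T" "seg v (i, j) \<subseteq> h" for h
    using that e faceD[OF that(1)] face_of_subset[OF e(1) that(2)] by (simp add: edge_of_def)
  then have "(i, j) \<in> bd h \<or> (j, i) \<in> bd h" if "h \<in> faces T" "seg v (i, j) \<subseteq> h" for h
    using edge_oriented that assms by (simp add: edges_iff)
  then show ?thesis using mem fg bd_face_unique by metis
qed

text \<open>Each of v j, v k lies to the left of the edge towards the other, so the triple product
  is zero and the three vertices would be collinear. The incoming case is the same with the signs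
  reversed.\<close>

lemma bd_out_unique:
  assumes f: "f \<in> faces T" and j: "(i, j) \<in> bd f" and k: "(i, k) \<in> bd f"
  shows "j = k"
proof (rule ccontr)
  assume "j \<noteq> k"
  have "cross3 (tau v i j) (tau v i k) \<bullet> normal f \<ge> 0" "cross3 (tau v i k) (tau v i j) \<bullet> normal f \<ge> 0"
    using bdD(7)[OF j bdD(6)[OF k]] bdD(7)[OF k bdD(6)[OF j]] by (simp_all add: tau_def)
  then have "cross3 (tau v i j) (tau v i k) \<bullet> normal f = 0"
    using cross_skew[of "tau v i j" "tau v i k"] by simp
  then have "cross3 (tau v i j) (tau v i k) = 0"
    using face_normal(1,2)[OF f] bdD(5,6)[OF j] bdD(5,6)[OF k]
    by (intro cross3_eq_0_of_perp[of "normal f"]) (auto simp: tau_def)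
  then have "collinear {v i, v j, v k}" using cross3_zero_imp_collinear by (simp add: tau_def)
  moreover have "\<not> collinear {v i, v j, v k}"
    using bdD[OF j] bdD[OF k] \<open>j \<noteq> k\<close> inj_vertex
    by (intro extreme_points_not_collinear[of _ T] vertex_extreme) auto
  ultimately show False by blast
qed

lemma bd_in_unique:
  assumes f: "f \<in> faces T" and j: "(j, i) \<in> bd f" and k: "(k, i) \<in> bd f"
  shows "j = k"
proof (rule ccontr)
  assume "j \<noteq> k"
  have "cross3 (tau v i j) (tau v i k) \<bullet> normal f \<le> 0" "cross3 (tau v i k) (tau v i j) \<bullet> normal f \<le> 0"
    using bdD(7)[OF j bdD(5)[OF k]] bdD(7)[OF k bdD(5)[OF j]]
    by (simp_all add: cross3_tau_rev[of _ i] tau_def[of _ i])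
  then have "cross3 (tau v i j) (tau v i k) \<bullet> normal f = 0"
    using cross_skew[of "tau v i j" "tau v i k"] by simp
  then have "cross3 (tau v i j) (tau v i k) = 0"
    using face_normal(1,2)[OF f] bdD(5,6)[OF j] bdD(5,6)[OF k]
    by (intro cross3_eq_0_of_perp[of "normal f"]) (auto simp: tau_def)
  then have "collinear {v i, v j, v k}" using cross3_zero_imp_collinear by (simp add: tau_def)
  moreover have "\<not> collinear {v i, v j, v k}"
    using bdD[OF j] bdD[OF k] \<open>j \<noteq> k\<close> inj_vertex
    by (intro extreme_points_not_collinear[of _ T] vertex_extreme) auto
  ultimately show False by blast
qed

text \<open>A vertex has codimension two in the polygon, hence lies on two of its edges; two
  outgoing or two incoming ones are impossible, so there is one of each.\<close>

lemma bd_at_vertex: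
  assumes f: "f \<in> faces T" and i: "i \<in> face_verts n v f"
  obtains j k where "(i, j) \<in> bd f" "(k, i) \<in> bd f" "j \<noteq> k"
proof -
  have i': "i \<in> {1..n}" "v i \<in> f" using i by (auto simp: face_verts_def)
  have "v i extreme_point_of f"
    using i' faceD(1)[OF f] vertex_extreme by (simp add: extreme_point_of_face)
  then have "{v i} face_of f" by (simp add: face_of_singleton)
  then obtain e e' where e: "e facet_of f" "e' facet_of f" "{v i} \<subseteq> e" "{v i} \<subseteq> e'" "e \<noteq> e'"
    using polytope_two_facets_at_face[OF faceD(3)[OF f], of "{v i}"] faceD(2)[OF f] by auto
  then have ed: "e edge_of f" "e' edge_of f"
    using faceD(2)[OF f] by (auto simp: facet_of_def edge_of_def)
  obtain j where j: "(i, j) \<in> E" "e = seg v (i, j)"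
    using edge_at_vertex[OF edge_of_face[OF ed(1) faceD(1)[OF f]]] e i' by blast
  obtain k where k: "(i, k) \<in> E" "e' = seg v (i, k)"
    using edge_at_vertex[OF edge_of_face[OF ed(2) faceD(1)[OF f]]] e i' by blast
  have "j \<noteq> k" using e j k by blast
  moreover have "(i, j) \<in> bd f \<or> (j, i) \<in> bd f" "(i, k) \<in> bd f \<or> (k, i) \<in> bd f"
    using edge_oriented[OF f] j k ed by (auto simp: edges_iff)
  ultimately show thesis using that bd_out_unique[OF f] bd_in_unique[OF f] by metis
qed

lemma bd_verts: "(i, j) \<in> bd f \<Longrightarrow> i \<in> face_verts n v f \<and> j \<in> face_verts n v f"
  using bdD[of i j f] by (simp add: face_verts_def)

end

section \<open>Topology of the surface\<close>

context polyhedron3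
begin

section \<open>Generic heights, connectedness of the edge graph and of links\<close>

text \<open>A generic c is orthogonal to no difference of two vertices. The sweep by such a height
  meets the vertices one at a time.\<close>

lemma injective_height: "\<exists>c. inj_on (\<lambda>i. c \<bullet> v i) {1..n}"
proof -
  let ?W = "(\<lambda>(i, j). v i - v j) ` {(i, j) \<in> {1..n} \<times> {1..n}. i \<noteq> j}"
  have "finite ?W" by (rule finite_imageI, rule finite_subset[of _ "{1..n} \<times> {1..n}"]) auto
  moreover have "0 \<notin> ?W" using inj_vertex by fastforce
  ultimately obtain c where c: "\<forall>w\<in>?W. c \<bullet> w \<noteq> 0"
    using ex_generic_functional[of ?W UNIV] by auto
  have "inj_on (\<lambda>i. c \<bullet> v i) {1..n}"
  proof (rule inj_onI, rule ccontr)
    fix i j assume ij: "i \<in> {1..n}" "j \<in> {1..n}" "c \<bullet> v i = c \<bullet> v j" "i \<noteq> j"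
    then have "v i - v j \<in> ?W" by (intro image_eqI[of _ _ "(i, j)"]) auto
    then have "c \<bullet> (v i - v j) \<noteq> 0" using c by blast
    then show False using ij(3) by (simp add: inner_diff_right)
  qed
  then show ?thesis ..
qed

text \<open>Everything else in the face obtained by pivoting at v i lies strictly below v i, so any
  of its edges at v i descends.\<close>

lemma descending_edge:
  assumes i: "i \<in> {1..n}" and y: "y \<in> T" "c \<bullet> y < c \<bullet> v i"
  obtains j where "(i, j) \<in> E" "c \<bullet> v j < c \<bullet> v i"
proof -
  have "{v i} face_of T" using vertex_extreme[OF i] by (simp add: face_of_singleton)
  then obtain G where G: "G face_of T" "{v i} \<subset> G" "\<And>x. x \<in> G - {v i} \<Longrightarrow> c \<bullet> x < c \<bullet> v i"
    using polytope_descending_face[OF polytope_T _ _ y] by blast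
  have "v i extreme_point_of G"
    using G vertex_extreme[OF i] by (auto simp: extreme_point_of_face)
  moreover have "polytope G" using G(1) face_of_polytope_polytope polytope_T by blast
  ultimately obtain e where e: "e edge_of G" "v i \<in> e"
    using polytope_edge_at_vertex[of G "v i"] G(2) by blast
  obtain j where j: "(i, j) \<in> E" "e = seg v (i, j)"
    using edge_at_vertex[OF edge_of_face[OF e(1) G(1)] e(2) i] .
  have "v j \<in> G" using edge_of_imp_subset[OF e(1)] j(2) ends_in_seg(2)[of j i] by blast
  moreover have "v j \<noteq> v i" using j(1) inj_vertex by (simp add: edges_iff)
  ultimately show thesis using that j(1) G(3) by blast
qed

text \<open>Connectedness of the edge graph: from every vertex descending edges lead to the lowest
  one. The induction counts the vertices lying lower.\<close>

lemma constant_along_edges: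
  assumes eq: "\<And>i j. (i, j) \<in> E \<Longrightarrow> \<phi> i = \<phi> j" and ij: "i \<in> {1..n}" "j \<in> {1..n}"
  shows "\<phi> i = \<phi> j"
proof -
  obtain c where inj: "inj_on (\<lambda>i. c \<bullet> v i) {1..n}" using injective_height by blast
  define m where "m = arg_min_on (\<lambda>i. c \<bullet> v i) {1..n}"
  have "{1..n} \<noteq> {}" using ij(1) by blast
  then have m: "m \<in> {1..n}" "\<And>i. i \<in> {1..n} \<Longrightarrow> c \<bullet> v m \<le> c \<bullet> v i"
    using arg_min_if_finite[of "{1..n}" "\<lambda>i. c \<bullet> v i"] unfolding m_def not_less[symmetric] by blast+
  have "\<phi> i = \<phi> m" if "i \<in> {1..n}" for i
    using that
  proof (induction "card {k \<in> {1..n}. c \<bullet> v k < c \<bullet> v i}" arbitrary: i rule: less_induct)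
    case less
    show ?case
    proof (cases "i = m")
      case False
      then have "c \<bullet> v m \<noteq> c \<bullet> v i" using inj_on_eq_iff[OF inj m(1) less.prems] by simp
      then have "c \<bullet> v m < c \<bullet> v i" using m(2)[OF less.prems] by simp
      then obtain j where j: "(i, j) \<in> E" "c \<bullet> v j < c \<bullet> v i"
        using descending_edge[OF less.prems vertex_in_T[OF m(1)]] by blast
      have jn: "j \<in> {1..n}" using j(1) by (simp add: edges_iff)
      have "{k \<in> {1..n}. c \<bullet> v k < c \<bullet> v j} \<subset> {k \<in> {1..n}. c \<bullet> v k < c \<bullet> v i}"
        using j(2) jn by force
      then have "\<phi> j = \<phi> m" using less.hyps[OF _ jn] by (simp add: psubset_card_mono)
      then show ?thesis using eq[OF j(1)] by simp
    qed simp
  qed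
  then show ?thesis using ij by simp
qed

text \<open>The edges at \<open>v i\<close> are ordered by their slopes, the heights of their traces on a plane
  cutting off \<open>v i\<close>, with respect to a height function there; pivoting around an edge of
  non-minimal slope yields a face at \<open>v i\<close> that contains this edge and one of smaller slope.\<close>

lemma lower_link_connected:
  assumes i: "i \<in> {1..n}" and c: "\<And>j. j \<in> {1..n} \<Longrightarrow> j \<noteq> i \<Longrightarrow> c \<bullet> v j \<noteq> c \<bullet> v i"
    and step: "\<And>f j k. f \<in> faces T \<Longrightarrow> (i, j) \<in> bd f \<Longrightarrow> (k, i) \<in> bd f \<Longrightarrow>
      (\<And>m. m \<in> face_verts n v f \<Longrightarrow> m \<noteq> i \<Longrightarrow> c \<bullet> v m < c \<bullet> v i) \<Longrightarrow> \<beta> j = \<beta> k"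
    and j: "(i, j) \<in> E" "c \<bullet> v j < c \<bullet> v i" and k: "(i, k) \<in> E" "c \<bullet> v k < c \<bullet> v i"
  shows "\<beta> j = \<beta> k"
proof -
  let ?I = "{1..n} - {i}"
  let ?t = "\<lambda>j. v j - v i"
  \<comment> \<open>Level planes of these functionals slightly above their value at v i cut off v i
    from the other vertices; the negated functional exposing v i is one of them.\<close>
  define U where "U = (\<Inter>j\<in>?I. {k. 0 < k \<bullet> ?t j})"
  have "open U"
    unfolding U_def by (intro open_INT) (auto intro!: open_Collect_less continuous_intros)
  moreover have "U \<noteq> {}"
  proof -
    have "{v i} exposed_face_of T"
      using vertex_extreme[OF i] by (simp add: exposed_face_of_polyhedron polyhedron_T face_of_singleton)
    then obtain a b where ab: "T \<subseteq> {x. a \<bullet> x \<le> b}" "{v i} = T \<inter> {x. a \<bullet> x = b}"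
      unfolding exposed_face_of_def by blast
    have "0 < - a \<bullet> ?t j" if "j \<in> ?I" for j
    proof -
      have "v j \<in> T" "v j \<noteq> v i" using that i vertex_in_T inj_vertex by auto
      then have "a \<bullet> v j \<le> b" "a \<bullet> v j \<noteq> b" "a \<bullet> v i = b" using ab by blast+
      then show ?thesis by (simp add: inner_diff_right)
    qed
    then have "- a \<in> U" unfolding U_def by blast
    then show ?thesis by blast
  qed
  \<comment> \<open>Orthogonality of g to an element of W would mean that two different directions
    have equal slopes.\<close>
  moreover define W where
    "W = (\<lambda>(j, l). (c \<bullet> ?t j) *\<^sub>R ?t l - (c \<bullet> ?t l) *\<^sub>R ?t j) ` {(j, l) \<in> ?I \<times> ?I. j \<noteq> l}"
  have "finite W"
    unfolding W_def by (rule finite_imageI, rule finite_subset[of _ "?I \<times> ?I"]) auto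
  moreover have "0 \<notin> W"
  proof
    assume "0 \<in> W"
    then obtain j l where jl: "j \<in> ?I" "l \<in> ?I" "j \<noteq> l" "(c \<bullet> ?t j) *\<^sub>R ?t l = (c \<bullet> ?t l) *\<^sub>R ?t j"
      unfolding W_def by auto
    have "c \<bullet> ?t j \<noteq> 0" using c jl(1) by (simp add: inner_diff_right)
    moreover have "(c \<bullet> ?t j) *\<^sub>R cross3 (?t j) (?t l) = 0"
      using jl(4) by (simp flip: cross_mult_right) (simp add: cross_mult_right)
    ultimately have "cross3 (?t j) (?t l) = 0" by simp
    then have "collinear {v i, v j, v l}" by (rule cross3_zero_imp_collinear)
    moreover have "\<not> collinear {v i, v j, v l}"
      using i jl inj_vertex by (intro extreme_points_not_collinear[of _ T] vertex_extreme) auto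
    ultimately show False by blast
  qed
  ultimately obtain g where g: "g \<in> U" "\<forall>w\<in>W. g \<bullet> w \<noteq> 0"
    using ex_generic_functional[of W U] by blast
  have gpos: "0 < g \<bullet> ?t j" if "j \<in> ?I" for j
    using g(1) that unfolding U_def by blast
  \<comment> \<open>The direction to v j meets the plane where g exceeds its value at v i by 1 in
    the point \<open>v i + ?t j /\<^sub>R (g \<bullet> ?t j)\<close>; \<open>s j\<close> is the
    height of this point above v i.\<close>
  define s where "s j = (c \<bullet> ?t j) / (g \<bullet> ?t j)" for j
  have s: "s j * (g \<bullet> ?t j) = c \<bullet> ?t j" if "j \<in> ?I" for j
    using gpos[OF that] by (simp add: s_def)
  have sinj: "s j \<noteq> s l" if "j \<in> ?I" "l \<in> ?I" "j \<noteq> l" for j l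
  proof
    assume "s j = s l"
    then have "(c \<bullet> ?t j) * (g \<bullet> ?t l) = (c \<bullet> ?t l) * (g \<bullet> ?t j)"
      unfolding s[OF that(1), symmetric] s[OF that(2), symmetric] by simp
    then have "g \<bullet> ((c \<bullet> ?t j) *\<^sub>R ?t l - (c \<bullet> ?t l) *\<^sub>R ?t j) = 0"
      by (simp only: inner_diff_right[of g "_ *\<^sub>R _"] inner_scaleR_right)
    moreover have "(c \<bullet> ?t j) *\<^sub>R ?t l - (c \<bullet> ?t l) *\<^sub>R ?t j \<in> W"
      unfolding W_def using that by (intro image_eqI[of _ _ "(j, l)"]) auto
    ultimately show False using g(2) by blast
  qed
  define N where "N = {j. (i, j) \<in> E \<and> c \<bullet> v j < c \<bullet> v i}"
  have NI: "N \<subseteq> ?I" by (auto simp: N_def edges_iff)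
  then have finN: "finite N" by (rule finite_subset) simp
  have pivot: "\<exists>l\<in>N. s l < s j \<and> \<beta> l = \<beta> j" if jN: "j \<in> N" and hN: "h \<in> N" "s h < s j" for j h
  proof -
    have jI: "j \<in> ?I" and hI: "h \<in> ?I" using jN hN NI by auto
    have jE: "(i, j) \<in> E" using jN by (simp add: N_def)
    have sneg: "s j < 0"
      using jN gpos[OF jI] by (simp add: N_def s_def divide_neg_pos inner_diff_right)
    \<comment> \<open>Constant along the edge; at any other vertex its sign relative to v i compares
      the slope there with \<open>s j\<close>.\<close>
    let ?c = "c - s j *\<^sub>R g"
    have ct: "?c \<bullet> v m - ?c \<bullet> v i = (s m - s j) * (g \<bullet> ?t m)" if "m \<in> ?I" for m
    proof -
      have "?c \<bullet> v m - ?c \<bullet> v i = c \<bullet> ?t m - s j * (g \<bullet> ?t m)"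
        by (simp add: algebra_simps inner_diff_left inner_diff_right)
      then show ?thesis using s[OF that] by (simp add: algebra_simps)
    qed
    have onseg: "?c \<bullet> x = ?c \<bullet> v i" if x: "x \<in> seg v (i, j)" for x
    proof -
      obtain u where "x = (1 - u) *\<^sub>R v i + u *\<^sub>R v j"
        using x by (auto simp: seg_def in_segment)
      then have "x = v i + u *\<^sub>R (v j - v i)" by (simp add: algebra_simps)
      then have "?c \<bullet> x = ?c \<bullet> v i + u * (?c \<bullet> v j - ?c \<bullet> v i)"
        by (simp only: inner_add_right inner_scaleR_right inner_diff_right)
      then show ?thesis using ct[OF jI] by simp
    qed
    have face: "seg v (i, j) face_of T" and dim1: "aff_dim (seg v (i, j)) = 1"
      using jE by (auto simp: edges_iff edge_of_def)
    have "?c \<bullet> v h < ?c \<bullet> v i"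
      using ct[OF hI] hN(2) gpos[OF hI] mult_neg_pos[of "s h - s j" "g \<bullet> ?t h"] by linarith
    moreover have "v h \<in> T" using hI vertex_in_T by blast
    ultimately obtain G where G: "G face_of T" "seg v (i, j) \<subset> G"
      "\<And>x. x \<in> G - seg v (i, j) \<Longrightarrow> ?c \<bullet> x < ?c \<bullet> v i"
      using polytope_descending_face[OF polytope_T face onseg] by blast
    \<comment> \<open>If the pivot already yields T, any facet through the edge will do; otherwise G
      has dimension strictly between 1 and 3 and is a facet itself.\<close>
    obtain f where f: "f \<in> faces T" "seg v (i, j) \<subseteq> f" "f \<subseteq> G"
    proof (cases "G = T")
      case True
      have "seg v (i, j) \<noteq> {}" "seg v (i, j) \<noteq> T" using dim1 aff_dim_T by auto
      then obtain f where "f facet_of T" "seg v (i, j) \<subseteq> f"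
        using face_of_polyhedron_subset_facet[OF polyhedron_T face] by blast
      moreover from this have "f \<subseteq> T" by (simp add: facet_of_imp_subset)
      ultimately show thesis using that True by (auto simp: faces_def)
    next
      case False
      have "aff_dim G < 3" using face_of_aff_dim_lt[OF convex_T G(1) False] aff_dim_T by simp
      moreover have "aff_dim (seg v (i, j)) < aff_dim G"
        using face G by (intro face_of_aff_dim_lt) (auto simp: face_of_face face_of_imp_convex)
      ultimately have "G \<in> faces T"
        using G(1,2) dim1 aff_dim_T by (auto simp: faces_def facet_of_def)
      then show thesis using that G(2) by blast
    qed
    have "seg v (i, j) face_of f"
      using face_of_subset[OF face f(2)] faceD[OF f(1)] by blast
    then have "seg v (i, j) edge_of f" using dim1 by (simp add: edge_of_def)
    then have j_or: "(i, j) \<in> bd f \<or> (j, i) \<in> bd f"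
      using edge_oriented[OF f(1)] jE by (simp add: edges_iff)
    have "i \<in> face_verts n v f" using i f(2) ends_in_seg(1)[of i j] by (auto simp: face_verts_def)
    then obtain p q where pq: "(i, p) \<in> bd f" "(q, i) \<in> bd f" "p \<noteq> q"
      using bd_at_vertex[OF f(1)] by blast
    have pqE: "(i, p) \<in> E" "(i, q) \<in> E"
      using bd_subset_edges[OF f(1)] pq edges_commute by blast+
    have low: "s m < s j" if m: "m \<in> face_verts n v f" "m \<noteq> i" "m \<noteq> j" for m
    proof -
      have mI: "m \<in> ?I" and "v m \<in> G" using m f(3) by (auto simp: face_verts_def)
      moreover have "v m \<notin> seg v (i, j)" using vertex_in_seg[OF jE] m mI by blast
      ultimately have "?c \<bullet> v m - ?c \<bullet> v i < 0" using G(3) by fastforce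
      then have "(s m - s j) * (g \<bullet> ?t m) < 0" using ct[OF mI] by simp
      then show ?thesis using gpos[OF mI] by (simp add: mult_less_0_iff)
    qed
    \<comment> \<open>Slopes in f are at most \<open>s j\<close>, which is negative, so all other
      vertices of f lie below v i and \<open>step\<close> applies.\<close>
    have top: "c \<bullet> v m < c \<bullet> v i" if m: "m \<in> face_verts n v f" "m \<noteq> i" for m
    proof -
      have mI: "m \<in> ?I" using m by (auto simp: face_verts_def)
      have "s m < 0" using low[OF m] sneg by (cases "m = j") auto
      then have "c \<bullet> ?t m < 0" using s[OF mI] gpos[OF mI] by (metis mult_neg_pos)
      then show ?thesis by (simp add: inner_diff_right)
    qed
    have eq: "\<beta> p = \<beta> q" by (rule step[OF f(1) pq(1,2) top])
    have pqv: "p \<in> face_verts n v f" "q \<in> face_verts n v f" "p \<noteq> i" "q \<noteq> i"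
      using bd_verts pq pqE by (auto simp: edges_iff)
    \<comment> \<open>One of the two edges of f at v i is the given one, and the other has a smaller
      slope.\<close>
    from j_or show ?thesis
    proof
      assume "(i, j) \<in> bd f"
      then have "p = j" using bd_out_unique[OF f(1)] pq by blast
      then have "q \<in> N" "s q < s j" "\<beta> q = \<beta> j"
        using pqE top low pqv eq pq(3) by (auto simp: N_def)
      then show ?thesis by blast
    next
      assume "(j, i) \<in> bd f"
      then have "q = j" using bd_in_unique[OF f(1)] pq by blast
      then have "p \<in> N" "s p < s j" "\<beta> p = \<beta> j"
        using pqE top low pqv eq pq(3) by (auto simp: N_def)
      then show ?thesis by blast
    qed
  qed
  have "j \<in> N" "k \<in> N" using j k by (auto simp: N_def)
  \<comment> \<open>Repeated pivots lead from any edge descending from v i to the one of least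
    slope.\<close>
  define h where "h = arg_min_on s N"
  have h: "h \<in> N" "\<And>j. j \<in> N \<Longrightarrow> s h \<le> s j"
    using arg_min_if_finite[OF finN, of s] \<open>j \<in> N\<close> unfolding h_def by (auto simp: not_less)
  have "\<beta> j = \<beta> h" if "j \<in> N" for j
    using that
  proof (induction "card {l \<in> N. s l < s j}" arbitrary: j rule: less_induct)
    case less
    show ?case
    proof (cases "j = h")
      case False
      have "h \<in> ?I" "j \<in> ?I" using h(1) less.prems NI by blast+
      then have "s h \<noteq> s j" using sinj[of h j] False by blast
      then have "s h < s j" using h(2)[OF less.prems] by simp
      then obtain l where l: "l \<in> N" "s l < s j" "\<beta> l = \<beta> j" using pivot[OF less.prems h(1)] by blast
      have "{m \<in> N. s m < s l} \<subset> {m \<in> N. s m < s j}" using l by force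
      then have "\<beta> l = \<beta> h" using less.hyps[OF _ l(1)] finN by (simp add: psubset_card_mono)
      then show ?thesis using l(3) by simp
    qed simp
  qed
  then show ?thesis using \<open>j \<in> N\<close> \<open>k \<in> N\<close> by simp
qed

text \<open>With the functional exposing v i as height, every other vertex is below v i, so the
  lower link is the whole link.\<close>

lemma link_connected:
  assumes i: "i \<in> {1..n}"
    and step: "\<And>f j k. f \<in> faces T \<Longrightarrow> (i, j) \<in> bd f \<Longrightarrow> (k, i) \<in> bd f \<Longrightarrow> \<beta> j = \<beta> k"
    and jk: "(i, j) \<in> E" "(i, k) \<in> E"
  shows "\<beta> j = \<beta> k"
proof -
  have "{v i} exposed_face_of T"
    using vertex_extreme[OF i] by (simp add: exposed_face_of_polyhedron polyhedron_T face_of_singleton)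
  then obtain a b where ab: "T \<subseteq> {x. a \<bullet> x \<le> b}" "{v i} = T \<inter> {x. a \<bullet> x = b}"
    unfolding exposed_face_of_def by blast
  have lt: "a \<bullet> v j < a \<bullet> v i" if "j \<in> {1..n}" "j \<noteq> i" for j
  proof -
    have "v j \<in> T" "v j \<noteq> v i" using that i vertex_in_T inj_vertex by auto
    then have "a \<bullet> v j \<le> b" "a \<bullet> v j \<noteq> b" "a \<bullet> v i = b" using ab by blast+
    then show ?thesis by simp
  qed
  have ltE: "a \<bullet> v j < a \<bullet> v i" if "(i, j) \<in> E" for j
    using lt that by (auto simp: edges_iff)
  show ?thesis
    by (rule lower_link_connected[OF i _ step jk(1) ltE[OF jk(1)] jk(2) ltE[OF jk(2)]])
      (use lt in fastforce)+
qed

section \<open>Closed edge functions and potentials\<close>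

lemma finite_bd: "f \<in> faces T \<Longrightarrow> finite (bd f)"
  using bd_subset_edges finite_edges finite_subset by blast

text \<open>The boundary leaves and enters each vertex of f exactly once, so starts and ends of its
  edges both run over all vertices of f and the two sums agree.\<close>

lemma sum_bd_coboundary:
  fixes \<phi> :: "nat \<Rightarrow> real"
  assumes f: "f \<in> faces T"
  shows "(\<Sum>(i, j)\<in>bd f. \<phi> j - \<phi> i) = 0"
proof -
  have inj: "inj_on fst (bd f)" "inj_on snd (bd f)"
    using bd_out_unique[OF f] bd_in_unique[OF f] by (fastforce simp: inj_on_def)+
  have img: "fst ` bd f = face_verts n v f" "snd ` bd f = face_verts n v f"
  proof -
    have "i \<in> fst ` bd f \<and> i \<in> snd ` bd f" if "i \<in> face_verts n v f" for i
    proof -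
      obtain j k where "(i, j) \<in> bd f" "(k, i) \<in> bd f" using bd_at_vertex[OF f \<open>i \<in> _\<close>] by blast
      then show ?thesis by force
    qed
    moreover have "fst e \<in> face_verts n v f \<and> snd e \<in> face_verts n v f" if "e \<in> bd f" for e
      using bd_verts[of "fst e" "snd e"] that by simp
    ultimately show "fst ` bd f = face_verts n v f" "snd ` bd f = face_verts n v f" by blast+
  qed
  have "(\<Sum>(i, j)\<in>bd f. \<phi> j - \<phi> i) = (\<Sum>e\<in>bd f. \<phi> (snd e)) - (\<Sum>e\<in>bd f. \<phi> (fst e))"
    by (simp add: case_prod_beta sum_subtractf)
  also have "\<dots> = sum \<phi> (snd ` bd f) - sum \<phi> (fst ` bd f)"
    using inj by (simp add: sum.reindex)
  finally show ?thesis by (simp add: img)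
qed

text \<open>Vanishing of the first cohomology of the surface of \<open>T\<close>: the potential is built by
  adding the vertices in the order of a generic height function, and connectedness of the
  lower links makes its value at the new vertex well defined.\<close>

lemma closed_imp_exact:
  fixes \<alpha> :: "nat \<Rightarrow> nat \<Rightarrow> real"
  assumes anti: "\<And>i j. (i, j) \<in> E \<Longrightarrow> \<alpha> j i = - \<alpha> i j"
    and closed: "\<And>f. f \<in> faces T \<Longrightarrow> (\<Sum>(i, j)\<in>bd f. \<alpha> i j) = 0"
  obtains \<phi> where "\<And>i j. (i, j) \<in> E \<Longrightarrow> \<alpha> i j = \<phi> j - \<phi> i"
proof -
  obtain c where inj: "inj_on (\<lambda>i. c \<bullet> v i) {1..n}" using injective_height by blast
  \<comment> \<open>The sets S are the stages of the sweep: with a vertex they contain all lower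
    ones.\<close>
  have "\<exists>\<phi>. \<forall>i\<in>S. \<forall>j\<in>S. (i, j) \<in> E \<longrightarrow> \<alpha> i j = \<phi> j - \<phi> i"
    if "S \<subseteq> {1..n}" "\<And>i j. i \<in> S \<Longrightarrow> j \<in> {1..n} \<Longrightarrow> c \<bullet> v j < c \<bullet> v i \<Longrightarrow> j \<in> S" for S
    using that
  proof (induction "card S" arbitrary: S)
    case 0
    then have "S = {}" using finite_subset by fastforce
    then show ?case by simp
  next
    case (Suc m)
    have finS: "finite S" using Suc.prems(1) finite_subset by blast
    have "S \<noteq> {}" using Suc.hyps(2) by auto
    define t where "t = arg_min_on (\<lambda>i. - (c \<bullet> v i)) S"
    have t: "t \<in> S" "c \<bullet> v i \<le> c \<bullet> v t" if "i \<in> S" for i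
      using arg_min_if_finite[OF finS \<open>S \<noteq> {}\<close>, of "\<lambda>i. - (c \<bullet> v i)"] that
      unfolding t_def[symmetric] by (simp_all add: not_less)
    have t: "t \<in> S" "\<And>i. i \<in> S \<Longrightarrow> c \<bullet> v i \<le> c \<bullet> v t"
      using t \<open>S \<noteq> {}\<close> by blast+
    have tn: "t \<in> {1..n}" using t Suc.prems(1) by blast
    have neq: "c \<bullet> v j \<noteq> c \<bullet> v t" if "j \<in> {1..n}" "j \<noteq> t" for j
      using inj_on_eq_iff[OF inj that(1) tn] that(2) by simp
    have lower: "j \<in> S - {t} \<longleftrightarrow> c \<bullet> v j < c \<bullet> v t" if "j \<in> {1..n}" for j
      using Suc.prems(2)[OF t(1) that] t(2) neq[OF that] by force
    have card: "m = card (S - {t})" using Suc.hyps(2) t(1) finS by simp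
    have down: "j \<in> S - {t}" if "i \<in> S - {t}" "j \<in> {1..n}" "c \<bullet> v j < c \<bullet> v i" for i j
      using that lower[of i] lower[of j] Suc.prems(1) by force
    have sub: "S - {t} \<subseteq> {1..n}" using Suc.prems(1) by blast
    obtain \<phi> where
      \<phi>: "\<And>i j. i \<in> S - {t} \<Longrightarrow> j \<in> S - {t} \<Longrightarrow> (i, j) \<in> E \<Longrightarrow> \<alpha> i j = \<phi> j - \<phi> i"
      using Suc.hyps(1)[OF card sub] down by blast
    have step: "\<phi> j + \<alpha> j t = \<phi> k + \<alpha> k t"
      if f: "f \<in> faces T" "(t, j) \<in> bd f" "(k, t) \<in> bd f"
        and top: "\<And>m. m \<in> face_verts n v f \<Longrightarrow> m \<noteq> t \<Longrightarrow> c \<bullet> v m < c \<bullet> v t" for f j k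
    proof -
      \<comment> \<open>The value of \<phi> at t carries no information at this stage and is
        replaced by 0. On the boundary of f only the two edges at t can then violate
        \<open>\<alpha> i j = \<psi> j - \<psi> i\<close>, and closedness relates them.\<close>
      define \<psi> where "\<psi> = \<phi>(t := 0)"
      have inE: "(t, j) \<in> E" "(k, t) \<in> E" using bd_subset_edges[OF f(1)] f by blast+
      have ne: "j \<noteq> t" "k \<noteq> t" using inE by (auto simp: edges_iff)
      have van: "(case e of (i, j) \<Rightarrow> \<alpha> i j - (\<psi> j - \<psi> i)) = 0" if e: "e \<in> bd f - {(t, j), (k, t)}" for e
      proof -
        obtain p q where pq: "e = (p, q)" by (cases e)
        have "p \<noteq> t" "q \<noteq> t" using e bd_out_unique[OF f(1,2)] bd_in_unique[OF f(1,3)] unfolding pq by auto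
        moreover have "p \<in> face_verts n v f" "q \<in> face_verts n v f" using e pq bd_verts by auto
        ultimately have "p \<in> S - {t}" "q \<in> S - {t}" using top lower by (auto simp: face_verts_def)
        moreover have "(p, q) \<in> E" using e pq bd_subset_edges[OF f(1)] by blast
        ultimately show ?thesis using \<phi> by (simp add: \<psi>_def pq)
      qed
      have "0 = (\<Sum>(i, j)\<in>bd f. \<alpha> i j) - (\<Sum>(i, j)\<in>bd f. \<psi> j - \<psi> i)"
        using closed[OF f(1)] sum_bd_coboundary[OF f(1), of \<psi>] by simp
      also have "\<dots> = (\<Sum>(i, j)\<in>bd f. \<alpha> i j - (\<psi> j - \<psi> i))"
        by (simp add: case_prod_beta sum_subtractf)
      also have "\<dots> = (\<Sum>(i, j)\<in>{(t, j), (k, t)}. \<alpha> i j - (\<psi> j - \<psi> i))"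
        using f van by (intro sum.mono_neutral_right finite_bd) auto
      also have "\<dots> = \<alpha> t j - \<phi> j + \<alpha> k t + \<phi> k"
        using ne by (simp add: \<psi>_def)
      finally show ?thesis using anti[OF inE(1)] by simp
    qed
    have link: "\<phi> j + \<alpha> j t = \<phi> k + \<alpha> k t"
      if "(t, j) \<in> E" "c \<bullet> v j < c \<bullet> v t" "(t, k) \<in> E" "c \<bullet> v k < c \<bullet> v t" for j k
      by (rule lower_link_connected[of t c "\<lambda>j. \<phi> j + \<alpha> j t"]) (use tn neq step that in blast)+
    \<comment> \<open>The value of the potential at t; if t has no lower neighbour, any r
      serves.\<close>
    obtain r where r: "\<And>j. (t, j) \<in> E \<Longrightarrow> c \<bullet> v j < c \<bullet> v t \<Longrightarrow> \<phi> j + \<alpha> j t = r"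
      using link by metis
    have low: "c \<bullet> v j < c \<bullet> v t" if "j \<in> S" "(t, j) \<in> E" for j
      using that lower[of j] by (auto simp: edges_iff)
    have "\<alpha> i j = (\<phi>(t := r)) j - (\<phi>(t := r)) i" if "i \<in> S" "j \<in> S" "(i, j) \<in> E" for i j
    proof -
      have "i \<noteq> j" using that by (auto simp: edges_iff)
      then consider "i = t" "j \<noteq> t" | "j = t" "i \<noteq> t" | "i \<noteq> t" "j \<noteq> t" by blast
      then show ?thesis
      proof cases
        case 1
        then show ?thesis using r[of j] low[of j] that anti[of i j] by simp
      next
        case 2
        then show ?thesis using r[of i] low[of i] that edges_commute[of i j] by simp
      next
        case 3
        then show ?thesis using \<phi>[of i j] that by simp
      qed
    qed
    then show ?case by blast
  qed
  from this[of "{1..n}"] obtain \<phi> where "\<forall>i\<in>{1..n}. \<forall>j\<in>{1..n}. (i, j) \<in> E \<longrightarrow> \<alpha> i j = \<phi> j - \<phi> i"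
    by blast
  then show thesis using that by (auto simp: edges_iff)
qed

section \<open>Connectedness of the faces and sums over directed edges\<close>

text \<open>Faces around a vertex share the value of b because its link is connected; adjacent
  vertices share it through their common edge, so it spreads along the edge graph.\<close>

lemma constant_across_edges:
  assumes eq: "\<And>f g i j. f \<in> faces T \<Longrightarrow> g \<in> faces T \<Longrightarrow> (i, j) \<in> bd f \<Longrightarrow> (j, i) \<in> bd g \<Longrightarrow> b f = b g"
    and fg: "f \<in> faces T" "g \<in> faces T"
  shows "b f = b g"
proof -
  have "\<forall>e\<in>E. \<exists>f. f \<in> faces T \<and> e \<in> bd f" using edge_has_left_face by fast
  then obtain L where L: "\<And>e. e \<in> E \<Longrightarrow> L e \<in> faces T \<and> e \<in> bd (L e)"
    using bchoice[of E "\<lambda>e f. f \<in> faces T \<and> e \<in> bd f"] by blast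
  have bL: "b (L e) = b f" if "f \<in> faces T" "e \<in> bd f" for f e
    using that L bd_face_unique bd_subset_edges by (metis subsetD surj_pair)
  have sym: "b (L (i, j)) = b (L (j, i))" if "(i, j) \<in> E" for i j
    using that L edges_commute eq by blast
  \<comment> \<open>A face with boundary edges (k, i) and (i, j) is the left face of both, and
    reversing (k, i) does not change the value of b.\<close>
  have link: "b (L (i, j)) = b (L (i, k))" if "(i, j) \<in> E" "(i, k) \<in> E" for i j k
  proof (rule link_connected[of i "\<lambda>j. b (L (i, j))"])
    show "i \<in> {1..n}" using that by (simp add: edges_iff)
    fix f j k assume f: "f \<in> faces T" "(i, j) \<in> bd f" "(k, i) \<in> bd f"
    then have "(k, i) \<in> E" using bd_subset_edges by blast
    then show "b (L (i, j)) = b (L (i, k))" using bL f sym by metis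
  qed (rule that)+
  \<comment> \<open>Common value of b on the faces around vertex i; by \<open>link\<close> the
    chosen edge is immaterial.\<close>
  define \<gamma> where "\<gamma> i = b (L (i, SOME j. (i, j) \<in> E))" for i
  have \<gamma>: "\<gamma> i = b (L (i, j))" if "(i, j) \<in> E" for i j
    unfolding \<gamma>_def using that by (intro link) (rule someI)
  have \<gamma>E: "\<gamma> i = \<gamma> j" if "(i, j) \<in> E" for i j
    using \<gamma>[OF that] \<gamma>[of j i] that sym edges_commute by metis
  have "\<exists>i\<in>{1..n}. b f = \<gamma> i" if f: "f \<in> faces T" for f
  proof -
    obtain x where "x extreme_point_of f"
      using extreme_point_exists_convex faceD[OF f] polytope_imp_compact by blast
    then have x: "x extreme_point_of T" "x \<in> f" using extreme_point_of_face faceD(1)[OF f] by blast+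
    then obtain i where i: "i \<in> {1..n}" "v i = x" using vertex_index by blast
    then have "i \<in> face_verts n v f" using x by (simp add: face_verts_def)
    then obtain j where j: "(i, j) \<in> bd f" using bd_at_vertex[OF f] by blast
    then have "b f = \<gamma> i" using \<gamma> bL[OF f] bd_subset_edges[OF f] by (metis subsetD)
    then show ?thesis using i by blast
  qed
  then show ?thesis using constant_along_edges[of \<gamma>] \<gamma>E fg by metis
qed

text \<open>Every directed edge has exactly one face to its left, so the face boundaries partition
  the directed edges.\<close>

lemma sum_bd_faces:
  "(\<Sum>f\<in>faces T. \<Sum>e\<in>bd f. h e) = sum h E"
proof -
  have "(\<Union>f\<in>faces T. bd f) = E"
    using bd_subset_edges edge_has_left_face by fast
  moreover have "\<forall>f\<in>faces T. \<forall>g\<in>faces T. f \<noteq> g \<longrightarrow> bd f \<inter> bd g = {}"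
    using bd_face_unique by fast
  ultimately show ?thesis
    using sum.UNION_disjoint[of "faces T" bd h] finite_faces finite_bd by simp
qed

lemma sum_edges_antisymmetric:
  fixes h :: "nat \<times> nat \<Rightarrow> 'b::real_vector"
  assumes "\<And>i j. (i, j) \<in> E \<Longrightarrow> h (j, i) = - h (i, j)"
  shows "sum h E = 0"
proof -
  have "sum h E = (\<Sum>e\<in>E. - h e)"
  proof (rule sum.reindex_bij_witness[of _ prod.swap prod.swap])
    fix e assume "e \<in> E"
    then show "prod.swap e \<in> E" "prod.swap e \<in> E" "- h (prod.swap e) = h e"
      using edges_commute[of "fst e" "snd e"] assms[of "fst e" "snd e"] by (cases e; simp)+
  qed auto
  then have "sum h E = - sum h E" by (simp add: sum_negf)
  then have "2 *\<^sub>R sum h E = 0" by (simp add: scaleR_2 eq_neg_iff_add_eq_0)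
  then show ?thesis by simp
qed

text \<open>Passes from prefixed directions to boundary directions: a boundary edge running against
  its prefixed direction is counted through its reversal, where the incidence -1 and the
  antisymmetry of h cancel.\<close>

lemma sum_orientation_incidence:
  fixes h :: "nat \<times> nat \<Rightarrow> real"
  assumes Ep: "edge_orientation T n v Ep" and f: "f \<in> faces T"
    and anti: "\<And>i j. (i, j) \<in> E \<Longrightarrow> h (j, i) = - h (i, j)"
  shows "(\<Sum>e\<in>Ep. (if e \<in> bd f then 1 else if (snd e, fst e) \<in> bd f then -1 else 0) * h e)
    = (\<Sum>e\<in>bd f. h e)"
proof -
  have EpE: "Ep \<subseteq> E" and o: "\<And>i j. (i, j) \<in> E \<Longrightarrow> (i, j) \<in> Ep \<longleftrightarrow> (j, i) \<notin> Ep"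
    using Ep by (auto simp: edge_orientation_def)
  have fin: "finite Ep" using EpE finite_edges finite_subset by blast
  have "(\<Sum>e\<in>bd f. h e) = (\<Sum>e\<in>bd f \<inter> Ep. h e) + (\<Sum>e\<in>bd f - Ep. h e)"
    using finite_bd[OF f] by (metis sum.Int_Diff)
  also have "(\<Sum>e\<in>bd f - Ep. h e) = (\<Sum>e\<in>{e \<in> Ep. prod.swap e \<in> bd f}. - h e)"
  proof (rule sum.reindex_bij_witness[of _ prod.swap prod.swap])
    show "prod.swap e \<in> bd f - Ep" if "e \<in> {e \<in> Ep. prod.swap e \<in> bd f}" for e
      using that o[of "fst e" "snd e"] EpE by (cases e) auto
    show "prod.swap e \<in> {e \<in> Ep. prod.swap e \<in> bd f}" if "e \<in> bd f - Ep" for e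
      using that o[of "fst e" "snd e"] bd_subset_edges[OF f] by (cases e) auto
    show "- h (prod.swap e) = h e" if "e \<in> bd f - Ep" for e
      using that anti bd_subset_edges[OF f] by (cases e) auto
  qed auto
  also have "(\<Sum>e\<in>bd f \<inter> Ep. h e) = (\<Sum>e\<in>Ep. if e \<in> bd f then h e else 0)"
    using fin by (simp add: sum.inter_restrict Int_commute)
  also have "(\<Sum>e\<in>{e \<in> Ep. prod.swap e \<in> bd f}. - h e) = (\<Sum>e\<in>Ep. if prod.swap e \<in> bd f then - h e else 0)"
    using fin by (simp add: sum.inter_filter)
  finally show ?thesis
    unfolding sum.distrib[symmetric]
    using bd_asym[OF f] by (auto simp: prod.swap_def intro!: sum.cong)
qed

end

section \<open>Degrees of freedom\<close>

lemma sum_fun_apply: "(\<Sum>i\<in>I. F i) x = (\<Sum>i\<in>I. F i x)"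
  by (induction I rule: infinite_finite_induct) auto

text \<open>Summation runs over indices, not over the image, so that coefficients belong to
  vertices, faces and edges even where F takes a value twice.\<close>

lemma span_image_eq_range_sum:
  fixes F :: "'i \<Rightarrow> 'b::real_vector"
  assumes "finite I"
  shows "span (F ` I) = range (\<lambda>a. \<Sum>i\<in>I. a i *\<^sub>R F i)"
proof
  show "span (F ` I) \<subseteq> range (\<lambda>a. \<Sum>i\<in>I. a i *\<^sub>R F i)"
  proof (rule span_minimal)
    show "F ` I \<subseteq> range (\<lambda>a. \<Sum>i\<in>I. a i *\<^sub>R F i)"
    proof
      fix u assume "u \<in> F ` I"
      then obtain j where j: "j \<in> I" "u = F j" by auto
      have "(\<Sum>i\<in>I. (if i = j then 1 else 0) *\<^sub>R F i) = (\<Sum>i\<in>I. if i = j then F i else 0)"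
        by (intro sum.cong) auto
      also have "\<dots> = u" using j assms by simp
      finally show "u \<in> range (\<lambda>a. \<Sum>i\<in>I. a i *\<^sub>R F i)"
        by (intro range_eqI[of _ _ "\<lambda>i. if i = j then 1 else 0"]) (rule sym)
    qed
    show "subspace (range (\<lambda>a. \<Sum>i\<in>I. a i *\<^sub>R F i))"
    proof (rule subspaceI)
      show "0 \<in> range (\<lambda>a. \<Sum>i\<in>I. a i *\<^sub>R F i)" by (rule range_eqI[of _ _ "\<lambda>_. 0"]) simp
    next
      fix x y
      assume "x \<in> range (\<lambda>a. \<Sum>i\<in>I. a i *\<^sub>R F i)" "y \<in> range (\<lambda>a. \<Sum>i\<in>I. a i *\<^sub>R F i)"
      then obtain a b where "x = (\<Sum>i\<in>I. a i *\<^sub>R F i)" "y = (\<Sum>i\<in>I. b i *\<^sub>R F i)" by auto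
      then show "x + y \<in> range (\<lambda>a. \<Sum>i\<in>I. a i *\<^sub>R F i)"
        by (intro range_eqI[of _ _ "\<lambda>i. a i + b i"]) (simp add: scaleR_add_left sum.distrib)
    next
      fix c x assume "x \<in> range (\<lambda>a. \<Sum>i\<in>I. a i *\<^sub>R F i)"
      then obtain a where "x = (\<Sum>i\<in>I. a i *\<^sub>R F i)" by auto
      then show "c *\<^sub>R x \<in> range (\<lambda>a. \<Sum>i\<in>I. a i *\<^sub>R F i)"
        by (intro range_eqI[of _ _ "\<lambda>i. c * a i"]) (simp add: scaleR_sum_right)
    qed
  qed
  show "range (\<lambda>a. \<Sum>i\<in>I. a i *\<^sub>R F i) \<subseteq> span (F ` I)"
    by (intro image_subsetI span_sum span_scale span_base imageI)
qed

text \<open>Otherwise some linear functional vanishes on S but not at y; its coordinates on I form a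
  z orthogonal to S, which is zero by \<open>ker\<close>.\<close>

lemma finite_fredholm_alternative:
  fixes S :: "('e \<Rightarrow> real) set"
  assumes I: "finite I"
    and ker: "\<And>z. (\<And>u. u \<in> S \<Longrightarrow> (\<Sum>e\<in>I. z e * u e) = 0) \<Longrightarrow> \<forall>e\<in>I. z e = 0"
  obtains w where "w \<in> span S" "\<And>e. e \<in> I \<Longrightarrow> w e = y e"
proof -
  \<comment> \<open>Truncation to I: on truncated functions a linear functional is determined by its
    values on the unit vectors \<open>\<delta> e\<close>.\<close>
  define r :: "('e \<Rightarrow> real) \<Rightarrow> 'e \<Rightarrow> real" where "r u = (\<lambda>e. if e \<in> I then u e else 0)" for u
  have lin: "linear r"
    by (rule linearI) (auto simp: r_def scaleR_fun_def fun_eq_iff)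
  define \<delta> :: "'e \<Rightarrow> 'e \<Rightarrow> real" where "\<delta> e = (\<lambda>x. if x = e then 1 else 0)" for e
  have expand: "r u = (\<Sum>e\<in>I. u e *\<^sub>R \<delta> e)" for u
  proof
    fix x
    have "(\<Sum>e\<in>I. u e *\<^sub>R \<delta> e) x = (\<Sum>e\<in>I. if x = e then u e else 0)"
      by (simp add: sum_fun_apply scaleR_fun_def \<delta>_def if_distrib cong: if_cong)
    then show "r u x = (\<Sum>e\<in>I. u e *\<^sub>R \<delta> e) x" using I by (simp add: r_def)
  qed
  have "r y \<in> span (r ` S)"
  proof (rule ccontr)
    assume neg: "r y \<notin> span (r ` S)"
    obtain B where B: "B \<subseteq> r ` S" "independent B" "r ` S \<subseteq> span B"
      using maximal_independent_subset by blast
    have "r y \<notin> span B" using neg B(1) span_mono by blast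
    then have "independent (insert (r y) B)" using B(2) by (simp add: independent_insert)
    then obtain g :: "('e \<Rightarrow> real) \<Rightarrow> real" where g: "linear g"
      "\<forall>x\<in>insert (r y) B. g x = (if x = r y then 1 else 0)"
      using linear_independent_extend[of "insert (r y) B" "\<lambda>x. if x = r y then 1 else 0"] by blast
    have "B \<subseteq> {x. g x = 0}" using g(2) \<open>r y \<notin> span B\<close> span_base by fastforce
    then have "span B \<subseteq> {x. g x = 0}"
      using g(1) by (intro span_minimal) (auto simp: linear_subspace_kernel)
    then have g0: "g (r u) = 0" if "u \<in> S" for u using B(3) that by blast
    have gr: "g (r u) = (\<Sum>e\<in>I. g (\<delta> e) * u e)" for u
      by (simp add: expand linear_sum[OF g(1)] linear_scale[OF g(1)] mult.commute)
    have "\<forall>e\<in>I. g (\<delta> e) = 0" by (rule ker) (use g0 gr in metis)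
    then have "g (r y) = 0" by (simp add: gr)
    then show False using g(2) by simp
  qed
  then obtain w where "w \<in> span S" "r w = r y"
    using linear_span_image[OF lin, of S] by auto
  then show thesis using that by (metis r_def)
qed

section \<open>One-sided derivatives\<close>

text \<open>At boundary points only directions staying in S can be tested. Restriction to the
  segment turns \<open>D h\<close> into a one-sided derivative at 0 on [0, 1], which is
  unique.\<close>

lemma has_derivative_along_segment:
  fixes u :: "'a::real_normed_vector \<Rightarrow> real"
  assumes D: "(u has_derivative D) (at x within S)"
    and seg: "\<And>t. 0 \<le> t \<Longrightarrow> t \<le> 1 \<Longrightarrow> x + t *\<^sub>R h \<in> S \<and> u (x + t *\<^sub>R h) = u x + t * c"
  shows "D h = c"
proof -
  let ?g = "\<lambda>t::real. x + t *\<^sub>R h"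
  have g: "(?g has_derivative (\<lambda>t. t *\<^sub>R h)) (at 0 within cbox 0 1)"
    by (auto intro!: derivative_eq_intros)
  have "?g ` cbox 0 1 \<subseteq> S" using seg by auto
  then have "(u has_derivative D) (at (?g 0) within ?g ` cbox 0 1)"
    using has_derivative_subset[OF D] by simp
  from diff_chain_within[OF g this]
  have "((u \<circ> ?g) has_derivative (\<lambda>t. t *\<^sub>R D h)) (at 0 within cbox 0 1)"
    using has_derivative_linear[OF D] by (simp add: o_def linear_scale)
  then have 1: "((u \<circ> ?g) has_vector_derivative D h) (at 0 within cbox 0 1)"
    by (simp add: has_vector_derivative_def)
  have "((\<lambda>t. u x + t * c) has_vector_derivative c) (at 0 within cbox 0 1)"
    by (auto intro!: derivative_eq_intros simp: has_vector_derivative_def)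
  then have 2: "((u \<circ> ?g) has_vector_derivative c) (at 0 within cbox 0 1)"
    by (rule has_vector_derivative_transform[rotated 2]) (use seg in auto)
  show ?thesis
    by (rule vector_derivative_unique_within_closed_interval[of 0 1 0, OF _ _ 1 2]) auto
qed

text \<open>\<open>frechet_derivative\<close> is a choice, so the gradient is tied to some
  derivative within T at x; its values in given directions are afterwards read off along segments in
  T.\<close>

lemma grad_on_inner:
  assumes "x \<in> T" "(u has_derivative D) (at x within T)"
  shows "\<exists>D. (u has_derivative D) (at x within T) \<and> (\<forall>h. grad_on T u x \<bullet> h = D h)"
proof -
  let ?D = "frechet_derivative u (at x within T)"
  have D: "(u has_derivative ?D) (at x within T)"
    using assms by (meson differentiableI frechet_derivative_works)
  then have lin: "linear ?D" by (rule has_derivative_linear)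
  have "grad_on T u x \<bullet> h = ?D h" for h
  proof -
    have "h = (\<Sum>m\<in>UNIV. h $ m *\<^sub>R axis m 1)"
      using basis_expansion[of h] by (simp add: scalar_mult_eq_scaleR)
    then have "?D h = ?D (\<Sum>m\<in>UNIV. h $ m *\<^sub>R axis m 1)" by simp
    also have "\<dots> = (\<Sum>m\<in>UNIV. h $ m * ?D (axis m 1))"
      by (simp add: linear_sum[OF lin] linear_scale[OF lin])
    finally show ?thesis using assms(1) by (simp add: grad_on_def inner_vec_def mult.commute)
  qed
  then show ?thesis using D by blast
qed

section \<open>Tangential components on edges\<close>

locale barycentric_polyhedron = polyhedron3 T n v for T n v +
  fixes lam :: "nat \<Rightarrow> real^3 \<Rightarrow> real" and C :: "nat \<Rightarrow> nat \<Rightarrow> nat \<Rightarrow> real" and Ep :: "(nat \<times> nat) set"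
  assumes gbc: "gbc T {1..n} v lam" and a1: "assumption1 T n v lam"
    and orient: "edge_orientation T n v Ep"
begin

lemma Ep_subset: "Ep \<subseteq> E" and Ep_swap: "(i, j) \<in> E \<Longrightarrow> (i, j) \<in> Ep \<longleftrightarrow> (j, i) \<notin> Ep"
  using orient by (auto simp: edge_orientation_def)

lemma finite_Ep: "finite Ep"
  using Ep_subset finite_edges finite_subset by blast

lemma lam_vertex: "i \<in> {1..n} \<Longrightarrow> j \<in> {1..n} \<Longrightarrow> lam i (v j) = (if i = j then 1 else 0)"
  using a1 by (simp add: assumption1_def lagrange_at_def)

lemma sum_lam: "x \<in> T \<Longrightarrow> (\<Sum>i\<in>{1..n}. lam i x) = 1"
proof -
  have "affine_fun (\<lambda>_::real^3. 1)" unfolding affine_fun_def by (intro exI[of _ 0] exI[of _ 1]) simp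
  then show "x \<in> T \<Longrightarrow> ?thesis" using gbc unfolding gbc_def by fastforce
qed

lemma grad_lam:
  assumes "i \<in> {1..n}" "x \<in> T"
  obtains D where "(lam i has_derivative D) (at x within T)" "\<And>h. grad_on T (lam i) x \<bullet> h = D h"
proof -
  have "C1_on T (lam i)" using a1 assms(1) by (simp add: assumption1_def)
  then obtain g where "(lam i has_derivative (\<lambda>h. g x \<bullet> h)) (at x within T)"
    using assms(2) unfolding C1_on_def by blast
  then show thesis using grad_on_inner[OF assms(2)] that by blast
qed

text \<open>The coordinates sum to 1 on T, so the sum of the gradients at x is orthogonal to y - x
  for every y in T, and these directions do not lie in a plane. Off T the gradients are 0 by
  convention.\<close>

lemma sum_grad_lam: "(\<Sum>i\<in>{1..n}. grad_on T (lam i)) = 0"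
proof
  fix x
  let ?G = "\<Sum>i\<in>{1..n}. grad_on T (lam i) x"
  have "?G = 0"
  proof (cases "x \<in> T")
    case True
    have "\<forall>i\<in>{1..n}. \<exists>D. (lam i has_derivative D) (at x within T) \<and> (\<forall>h. grad_on T (lam i) x \<bullet> h = D h)"
      using grad_lam[OF _ True] by metis
    then obtain D where D: "\<And>i. i \<in> {1..n} \<Longrightarrow> (lam i has_derivative D i) (at x within T)"
      "\<And>i h. i \<in> {1..n} \<Longrightarrow> grad_on T (lam i) x \<bullet> h = D i h"
      using bchoice[of "{1..n}" "\<lambda>i D. (lam i has_derivative D) (at x within T) \<and> (\<forall>h. grad_on T (lam i) x \<bullet> h = D h)"]
      by blast
    have S: "((\<lambda>x. \<Sum>i\<in>{1..n}. lam i x) has_derivative (\<lambda>h. \<Sum>i\<in>{1..n}. D i h)) (at x within T)"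
      by (intro has_derivative_sum D(1))
    have "?G \<bullet> (y - x) = 0" if "y \<in> T" for y
    proof -
      have mem: "x + t *\<^sub>R (y - x) \<in> T" if "0 \<le> t" "t \<le> 1" for t
      proof -
        have "x + t *\<^sub>R (y - x) = (1 - t) *\<^sub>R x + t *\<^sub>R y" by (simp add: algebra_simps)
        then show ?thesis using convexD_alt[OF convex_T True \<open>y \<in> T\<close> that] by simp
      qed
      have "(\<Sum>i\<in>{1..n}. D i (y - x)) = 0"
        by (rule has_derivative_along_segment[OF S]) (use mem sum_lam True in simp)
      moreover have "?G \<bullet> (y - x) = (\<Sum>i\<in>{1..n}. D i (y - x))"
        unfolding inner_sum_left by (intro sum.cong D(2)) simp_all
      ultimately show ?thesis by simp
    qed
    then show ?thesis using not_in_plane by blast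
  qed (simp add: grad_on_def)
  then show "(\<Sum>i\<in>{1..n}. grad_on T (lam i)) x = 0 x"
    by (simp add: sum_fun_apply)
qed

text \<open>Read off on the face to the left of the edge: the coordinate of a vertex of this face is
  linear on the edge and fixed by the Lagrange property, that of any other vertex vanishes on the
  face.\<close>

lemma lam_edge:
  assumes pq: "(p, q) \<in> E" and k: "k \<in> {1..n}" and t: "0 \<le> t" "t \<le> 1"
  shows "lam k ((1 - t) *\<^sub>R v p + t *\<^sub>R v q) = (1 - t) * (if k = p then 1 else 0) + t * (if k = q then 1 else 0)"
proof -
  let ?x = "(1 - t) *\<^sub>R v p + t *\<^sub>R v q"
  obtain f where f: "f \<in> faces T" "(p, q) \<in> bd f" using edge_has_left_face[OF pq] by blast
  have x: "?x \<in> seg v (p, q)" using t by (auto simp: seg_def in_segment)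
  show ?thesis
  proof (cases "k \<in> face_verts n v f")
    case True
    then obtain L where L: "affine_fun L" "\<forall>x\<in>seg v (p, q). lam k x = L x"
      using a1 f bdD(1)[OF f(2)] unfolding assumption1_def by blast
    obtain a b where ab: "\<And>x. L x = a \<bullet> x + b" using L(1) unfolding affine_fun_def by blast
    have "lam k ?x = L ?x" using L(2) x by blast
    also have "\<dots> = (1 - t) * L (v p) + t * L (v q)"
      by (simp add: ab inner_add_right algebra_simps)
    also have "\<dots> = (1 - t) * lam k (v p) + t * lam k (v q)"
      using L(2) by (simp add: seg_def)
    finally show ?thesis using lam_vertex k pq by (simp add: edges_iff)
  next
    case False
    then have "lam k ?x = 0"
      using a1 f(1) k x edge_of_imp_subset[OF bdD(1)[OF f(2)]] unfolding assumption1_def by blast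
    moreover have "k \<noteq> p" "k \<noteq> q" using False bd_verts[OF f(2)] by auto
    ultimately show ?thesis by simp
  qed
qed

lemma seg_in_T: "(p, q) \<in> E \<Longrightarrow> x \<in> seg v (p, q) \<Longrightarrow> x \<in> T"
  using edge_of_imp_subset by (auto simp: edges_iff)

lemma grad_lam_edge:
  assumes pq: "(p, q) \<in> E" and k: "k \<in> {1..n}" and x: "x \<in> seg v (p, q)"
  shows "grad_on T (lam k) x \<bullet> tau v p q = (if k = q then 1 else 0) - (if k = p then 1 else 0)"
proof -
  let ?d = "(if k = q then 1 else 0) - (if k = p then 1 else 0) :: real"
  obtain t where t: "0 \<le> t" "t \<le> 1" "x = (1 - t) *\<^sub>R v p + t *\<^sub>R v q"
    using x by (auto simp: seg_def in_segment)
  \<comment> \<open>From x the segment runs to v q, except when x is v q itself and it runs back to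
    v p; in both cases it stays in the edge.\<close>
  define r where "r = (if t < 1 then 1 - t else - 1)"
  have r: "r \<noteq> 0" "\<And>s. 0 \<le> s \<Longrightarrow> s \<le> 1 \<Longrightarrow> 0 \<le> t + s * r \<and> t + s * r \<le> 1"
  proof -
    show "r \<noteq> 0" by (simp add: r_def)
    fix s :: real assume s: "0 \<le> s" "s \<le> 1"
    then have "s * (1 - t) \<le> 1 - t" "0 \<le> s * (1 - t)" using t by (simp_all add: mult_left_le_one_le)
    then have "0 \<le> t + s * r" "t + s * r \<le> 1"
      using s t unfolding r_def by (cases "t < 1"; simp only: if_True if_False; linarith)+
    then show "0 \<le> t + s * r \<and> t + s * r \<le> 1" ..
  qed
  obtain D where D: "(lam k has_derivative D) (at x within T)" "\<And>h. grad_on T (lam k) x \<bullet> h = D h"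
    using grad_lam[OF k seg_in_T[OF pq x]] by blast
  have "D (r *\<^sub>R tau v p q) = r * ?d"
  proof (rule has_derivative_along_segment[OF D(1)])
    fix s :: real assume s: "0 \<le> s" "s \<le> 1"
    have eq: "x + s *\<^sub>R r *\<^sub>R tau v p q = (1 - (t + s * r)) *\<^sub>R v p + (t + s * r) *\<^sub>R v q"
      by (simp add: t(3) tau_def algebra_simps)
    have "x + s *\<^sub>R r *\<^sub>R tau v p q \<in> T"
      unfolding eq using r(2)[OF s] by (intro seg_in_T[OF pq]) (auto simp: seg_def in_segment)
    moreover have "lam k (x + s *\<^sub>R r *\<^sub>R tau v p q) = lam k x + s * (r * ?d)"
      unfolding eq unfolding t(3) lam_edge[OF pq k t(1,2)]
        lam_edge[OF pq k r(2)[OF s, THEN conjunct1] r(2)[OF s, THEN conjunct2]]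
      by (simp add: algebra_simps)
    ultimately show "x + s *\<^sub>R r *\<^sub>R tau v p q \<in> T \<and> lam k (x + s *\<^sub>R r *\<^sub>R tau v p q) = lam k x + s * (r * ?d)"
      by blast
  qed
  then have "r * D (tau v p q) = r * ?d"
    using has_derivative_linear[OF D(1)] by (simp add: linear_scale)
  then show ?thesis using r(1) D(2) by simp
qed

text \<open>Each term is a coordinate of one index times a tangential derivative of the other, and
  both factors vanish on the edge unless their index is an end of it. For (p, q) the sum of the two
  end coordinates remains, which is 1.\<close>

lemma whitney_edge:
  assumes pq: "(p, q) \<in> E" and x: "x \<in> seg v (p, q)" and ij: "i \<in> {1..n}" "j \<in> {1..n}" "i \<noteq> j"
  shows "whitney T lam i j x \<bullet> tau v p q =
    (if (i, j) = (p, q) then 1 else if (j, i) = (p, q) then -1 else 0)"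
proof -
  obtain t where t: "0 \<le> t" "t \<le> 1" "x = (1 - t) *\<^sub>R v p + t *\<^sub>R v q"
    using x by (auto simp: seg_def in_segment)
  have "p \<noteq> q" using pq by (simp add: edges_iff)
  have "whitney T lam i j x \<bullet> tau v p q =
    lam i x * (grad_on T (lam j) x \<bullet> tau v p q) - lam j x * (grad_on T (lam i) x \<bullet> tau v p q)"
    by (simp add: whitney_def inner_diff_left)
  also have "\<dots> = (if (i, j) = (p, q) then 1 else if (j, i) = (p, q) then -1 else 0)"
    unfolding grad_lam_edge[OF pq ij(1) x] grad_lam_edge[OF pq ij(2) x]
    unfolding t(3) lam_edge[OF pq ij(1) t(1,2)] lam_edge[OF pq ij(2) t(1,2)]
    using \<open>p \<noteq> q\<close> ij(3) by (auto split: if_splits)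
  finally show ?thesis .
qed

lemma edge_not_diagonal:
  assumes "(i, j) \<in> E"
  shows "(i, j) \<notin> face_diagonals T n v" "(i, j) \<notin> interior_diagonals T n v"
proof -
  show "(i, j) \<notin> face_diagonals T n v" using assms by (simp add: face_diagonals_def)
  have F: "seg v (i, j) face_of T" "aff_dim (seg v (i, j)) = 1"
    using assms by (auto simp: edges_iff edge_of_def)
  then have "seg v (i, j) \<noteq> T" using aff_dim_T by auto
  then have "seg v (i, j) \<inter> interior T = {}" using face_of_disjoint_interior F(1) by blast
  moreover have "seg v (i, j) \<subseteq> closure T" using F(1) closure_subset face_of_imp_subset by blast
  ultimately have "seg v (i, j) \<subseteq> frontier T" by (auto simp: frontier_def)
  then show "(i, j) \<notin> interior_diagonals T n v" by (simp add: interior_diagonals_def)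
qed

lemma whitney_diagonal_edge:
  assumes pq: "(p, q) \<in> E" and x: "x \<in> seg v (p, q)"
    and ik: "(i, k) \<in> face_diagonals T n v \<or> (i, k) \<in> interior_diagonals T n v"
  shows "whitney T lam i k x \<bullet> tau v p q = 0"
proof -
  have "i \<in> {1..n}" "k \<in> {1..n}" "i \<noteq> k"
    using ik by (auto simp: face_diagonals_def interior_diagonals_def directed_segs_def)
  moreover have "(i, k) \<noteq> (p, q)" "(k, i) \<noteq> (p, q)"
    using ik edge_not_diagonal pq edges_commute by blast+
  ultimately show ?thesis using whitney_edge[OF pq x] by simp
qed

text \<open>The correction terms are Whitney forms of face and interior diagonals, which have no
  tangential component on edges.\<close>

lemma whitney_mod_edge:
  assumes pq: "(p, q) \<in> E" and x: "x \<in> seg v (p, q)" and ij: "(i, j) \<in> E"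
  shows "whitney_mod T n v lam C i j x \<bullet> tau v p q =
    (if (i, j) = (p, q) then 1 else if (j, i) = (p, q) then -1 else 0)"
proof -
  have "i \<in> {1..n}" "j \<in> {1..n}" "i \<noteq> j" using ij by (auto simp: edges_iff)
  then show ?thesis
    using whitney_edge[OF pq x, of i j]
    by (simp add: whitney_mod_def scaleR_fun_def sum_fun_apply inner_add_left inner_diff_left
        inner_sum_left whitney_diagonal_edge[OF pq x])
qed

lemma whitney_mod_swap: "whitney_mod T n v lam C j i = - whitney_mod T n v lam C i j"
proof -
  have "edge_nbhd_verts T n v j i = edge_nbhd_verts T n v i j"
    by (simp add: edge_nbhd_verts_def seg_commute)
  then show ?thesis
    by (simp add: whitney_mod_def whitney_def fun_eq_iff scaleR_fun_def algebra_simps)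
qed

lemma sum_whitney_face: "(\<Sum>f\<in>faces T. whitney_face T n v lam C f) = 0"
proof -
  let ?h = "\<lambda>e. whitney_mod T n v lam C (fst e) (snd e)"
  have "(\<Sum>f\<in>faces T. whitney_face T n v lam C f) = sum ?h E"
    unfolding whitney_face_def by (simp add: case_prod_beta sum_bd_faces)
  also have "\<dots> = 0" by (rule sum_edges_antisymmetric) (simp, rule whitney_mod_swap)
  finally show ?thesis .
qed

definition incidence :: "(real^3) set \<Rightarrow> nat \<times> nat \<Rightarrow> real" where
  "incidence f e = (if e \<in> bd f then 1 else if (snd e, fst e) \<in> bd f then -1 else 0)"

lemma whitney_face_edge:
  assumes pq: "(p, q) \<in> E" and x: "x \<in> seg v (p, q)" and f: "f \<in> faces T"
  shows "whitney_face T n v lam C f x \<bullet> tau v p q = incidence f (p, q)"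
proof -
  have "whitney_face T n v lam C f x \<bullet> tau v p q =
    (\<Sum>(i, j)\<in>bd f. whitney_mod T n v lam C i j x \<bullet> tau v p q)"
    by (simp add: whitney_face_def sum_fun_apply inner_sum_left case_prod_beta)
  also have "\<dots> = (\<Sum>e\<in>bd f. (if e = (p, q) then 1 else 0) + (if e = (q, p) then -1 else 0))"
  proof (intro sum.cong refl)
    fix e assume "e \<in> bd f"
    then have "(fst e, snd e) \<in> E" using bd_subset_edges[OF f] by auto
    moreover have "p \<noteq> q" using pq by (simp add: edges_iff)
    ultimately show "(case e of (i, j) \<Rightarrow> whitney_mod T n v lam C i j x \<bullet> tau v p q) =
        (if e = (p, q) then 1 else 0) + (if e = (q, p) then -1 else 0)"
      using whitney_mod_edge[OF pq x, of "fst e" "snd e"] by (cases e) auto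
  qed
  also have "\<dots> = incidence f (p, q)"
    using bd_asym[OF f] finite_bd[OF f] by (auto simp: sum.distrib incidence_def)
  finally show ?thesis .
qed

section \<open>Edge values as a function of the coefficients\<close>

definition field :: "(nat \<Rightarrow> real) \<Rightarrow> ((real^3) set \<Rightarrow> real) \<Rightarrow> real^3 \<Rightarrow> real^3" where
  "field a b = (\<Sum>i\<in>{1..n}. a i *\<^sub>R grad_on T (lam i)) + (\<Sum>f\<in>faces T. b f *\<^sub>R whitney_face T n v lam C f)"

definition dofs :: "(nat \<Rightarrow> real) \<Rightarrow> ((real^3) set \<Rightarrow> real) \<Rightarrow> nat \<times> nat \<Rightarrow> real" where
  "dofs a b e = (\<Sum>i\<in>{1..n}. vertex_entry v e i * a i) + (\<Sum>f\<in>faces T. face_entry T n v e f * b f)"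

abbreviation len :: "nat \<times> nat \<Rightarrow> real" where
  "len e \<equiv> norm (tau v (fst e) (snd e))"

lemma len_pos: "e \<in> E \<Longrightarrow> len e > 0"
  using inj_vertex by (cases e) (auto simp: tau_def edges_iff)

lemma vertex_entry_sum:
  assumes "e \<in> E"
  shows "(\<Sum>i\<in>{1..n}. vertex_entry v e i * a i) = (a (snd e) - a (fst e)) / len e"
proof -
  have e: "fst e \<in> {1..n}" "snd e \<in> {1..n}" "fst e \<noteq> snd e" using assms by (cases e; auto simp: edges_iff)+
  have "(\<Sum>i\<in>{1..n}. vertex_entry v e i * a i) =
    (\<Sum>i\<in>{1..n}. ((if i = snd e then a i else 0) - (if i = fst e then a i else 0)) / len e)"
    using e(3) by (intro sum.cong) (auto simp: vertex_entry_def)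
  also have "\<dots> =
    ((\<Sum>i\<in>{1..n}. if i = snd e then a i else 0) - (\<Sum>i\<in>{1..n}. if i = fst e then a i else 0)) / len e"
    by (simp only: sum_divide_distrib[symmetric] sum_subtractf)
  also have "(\<Sum>i\<in>{1..n}. if i = snd e then a i else 0) = a (snd e)"
    using e(2) by (simp only: sum.delta finite_atLeastAtMost if_True)
  also have "(\<Sum>i\<in>{1..n}. if i = fst e then a i else 0) = a (fst e)"
    using e(1) by (simp only: sum.delta finite_atLeastAtMost if_True)
  finally show ?thesis .
qed

lemma face_entry_eq: "face_entry T n v e f = incidence f e / len e"
  by (simp add: face_entry_def incidence_def)

lemma dofs_eq:
  assumes "e \<in> E"
  shows "dofs a b e = (a (snd e) - a (fst e) + (\<Sum>f\<in>faces T. incidence f e * b f)) / len e"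
  unfolding dofs_def vertex_entry_sum[OF assms]
  by (simp add: face_entry_eq add_divide_distrib sum_divide_distrib)

text \<open>The matrix entries are defined combinatorially; here they are identified with the
  tangential components of the spanning fields, constant along each edge.\<close>

lemma field_edge:
  assumes e: "e \<in> E" and x: "x \<in> seg v e"
  shows "field a b x \<bullet> unit_tangent v e = dofs a b e"
proof -
  obtain p q where pq: "e = (p, q)" by (cases e)
  have E: "(p, q) \<in> E" "x \<in> seg v (p, q)" using e x pq by auto
  have "field a b x \<bullet> tau v p q =
    (\<Sum>i\<in>{1..n}. a i * (grad_on T (lam i) x \<bullet> tau v p q)) +
    (\<Sum>f\<in>faces T. b f * (whitney_face T n v lam C f x \<bullet> tau v p q))"
    by (simp add: field_def sum_fun_apply scaleR_fun_def inner_add_left inner_sum_left)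
  also have "(\<Sum>i\<in>{1..n}. a i * (grad_on T (lam i) x \<bullet> tau v p q)) =
    (\<Sum>i\<in>{1..n}. (if i = q then a i else 0) - (if i = p then a i else 0))"
    by (intro sum.cong) (auto simp: grad_lam_edge[OF E(1) _ E(2)])
  also have "\<dots> = a q - a p" using E by (simp add: sum_subtractf edges_iff)
  also have "(\<Sum>f\<in>faces T. b f * (whitney_face T n v lam C f x \<bullet> tau v p q)) =
    (\<Sum>f\<in>faces T. incidence f e * b f)"
    by (intro sum.cong) (auto simp: whitney_face_edge[OF E] pq)
  finally show ?thesis
    unfolding dofs_eq[OF e] by (simp add: unit_tangent_def pq divide_inverse mult.commute)
qed

lemma dofs_diff: "dofs (\<lambda>i. a i - a' i) (\<lambda>f. b f - b' f) e = dofs a b e - dofs a' b' e"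
  by (simp add: dofs_def right_diff_distrib sum_subtractf)

lemma field_diff: "field (\<lambda>i. a i - a' i) (\<lambda>f. b f - b' f) = field a b - field a' b'"
  by (simp add: field_def scaleR_diff_left sum_subtractf)

lemma sum_incidence:
  assumes "f \<in> faces T" and "\<And>i j. (i, j) \<in> E \<Longrightarrow> h (j, i) = - h (i, j)"
  shows "(\<Sum>e\<in>Ep. incidence f e * h e) = (\<Sum>e\<in>bd f. h e)"
  unfolding incidence_def by (intro sum_orientation_incidence[OF orient assms(1)] assms(2))

text \<open>Coboundaries of vertex functions and boundaries of face functions are orthogonal, so both
  parts of a vanishing sum vanish; connectedness then makes the coefficients constant.\<close>

lemma field_eq_0:
  assumes "\<And>e. e \<in> Ep \<Longrightarrow> dofs a b e = 0"
  shows "field a b = 0"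
proof -
  \<comment> \<open>Up to the edge length, y is the contribution of the vertices to the edge value
    and w that of the faces.\<close>
  define y where "y e = a (snd e) - a (fst e)" for e :: "nat \<times> nat"
  define w where "w e = (\<Sum>f\<in>faces T. incidence f e * b f)" for e
  have yw: "w e = - y e" if "e \<in> Ep" for e
    using assms[OF that] len_pos[of e] Ep_subset that dofs_eq[of e a b] by (auto simp: y_def w_def)
  \<comment> \<open>Exchanging the sums leaves for every face the sum of y around its boundary,
    which is 0; as w = - y on \<open>Ep\<close>, the squares of y sum to 0.\<close>
  have "(\<Sum>e\<in>Ep. w e * y e) = (\<Sum>e\<in>Ep. \<Sum>f\<in>faces T. b f * (incidence f e * y e))"
    unfolding w_def sum_distrib_right by (intro sum.cong refl) simp
  also have "\<dots> = (\<Sum>f\<in>faces T. b f * (\<Sum>e\<in>Ep. incidence f e * y e))"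
    by (subst sum.swap) (simp add: sum_distrib_left)
  also have "\<dots> = 0"
  proof (intro sum.neutral ballI)
    fix f assume f: "f \<in> faces T"
    have "(\<Sum>e\<in>Ep. incidence f e * y e) = (\<Sum>e\<in>bd f. y e)"
      by (rule sum_incidence[OF f]) (simp add: y_def)
    also have "\<dots> = 0" using sum_bd_coboundary[OF f, of a] by (simp add: y_def case_prod_beta)
    finally show "b f * (\<Sum>e\<in>Ep. incidence f e * y e) = 0" by simp
  qed
  finally have "(\<Sum>e\<in>Ep. (y e)\<^sup>2) = 0"
    using yw by (simp add: power2_eq_square sum_negf)
  then have y0: "y e = 0" if "e \<in> Ep" for e
    using that finite_Ep by (simp add: sum_nonneg_eq_0_iff)
  then have w0: "w e = 0" if "e \<in> Ep" for e using yw that by simp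
  have aE: "a i = a j" if "(i, j) \<in> E" for i j
    using Ep_swap[OF that] y0[of "(i, j)"] y0[of "(j, i)"] by (auto simp: y_def)
  have a1: "a i = a 1" if "i \<in> {1..n}" for i
    by (rule constant_along_edges) (use aE that in auto)
  have "(\<Sum>i\<in>{1..n}. a i *\<^sub>R grad_on T (lam i)) = (\<Sum>i\<in>{1..n}. a 1 *\<^sub>R grad_on T (lam i))"
    by (intro sum.cong refl) (metis a1)
  also have "\<dots> = 0" by (simp only: sum_grad_lam scaleR_zero_right flip: scaleR_sum_right)
  finally have A: "(\<Sum>i\<in>{1..n}. a i *\<^sub>R grad_on T (lam i)) = 0" .
  have w_eq: "w (i, j) = b f - b g"
    if "f \<in> faces T" "g \<in> faces T" "(i, j) \<in> bd f" "(j, i) \<in> bd g" for f g i j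
  proof -
    have "incidence h (i, j) * b h = (if h = f then b h else 0) - (if h = g then b h else 0)"
      if "h \<in> faces T" for h
    proof -
      have "(i, j) \<in> bd h \<longleftrightarrow> h = f" "(j, i) \<in> bd h \<longleftrightarrow> h = g"
        using bd_face_unique that \<open>f \<in> faces T\<close> \<open>g \<in> faces T\<close> \<open>(i, j) \<in> bd f\<close> \<open>(j, i) \<in> bd g\<close> by blast+
      moreover have "f \<noteq> g" using bd_asym \<open>f \<in> faces T\<close> \<open>(i, j) \<in> bd f\<close> \<open>(j, i) \<in> bd g\<close> by blast
      ultimately show ?thesis
        using \<open>(i, j) \<in> bd f\<close> \<open>(j, i) \<in> bd g\<close> by (auto simp: incidence_def)
    qed
    then have "w (i, j) = (\<Sum>h\<in>faces T. (if h = f then b h else 0) - (if h = g then b h else 0))"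
      unfolding w_def by (intro sum.cong) auto
    then show ?thesis using that finite_faces by (simp add: sum_subtractf)
  qed
  have "b f = b g" if fg: "f \<in> faces T" "g \<in> faces T" "(i, j) \<in> bd f" "(j, i) \<in> bd g" for f g i j
  proof -
    have "(i, j) \<in> E" using bd_subset_edges fg by blast
    \<comment> \<open>Only one direction of the edge is in \<open>Ep\<close>; \<open>w_eq\<close>
      applies to it with f and g in one order or the other.\<close>
    then have "w (i, j) = 0 \<or> w (j, i) = 0" using Ep_swap w0 by blast
    then show ?thesis using w_eq[OF fg] w_eq[OF fg(2,1,4,3)] by auto
  qed
  then have const: "b f = b g" if "f \<in> faces T" "g \<in> faces T" for f g
    using constant_across_edges[of b] that by blast
  have B: "(\<Sum>f\<in>faces T. b f *\<^sub>R whitney_face T n v lam C f) = 0"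
  proof (cases "faces T = {}")
    case False
    then obtain g where g: "g \<in> faces T" by blast
    have "(\<Sum>f\<in>faces T. b f *\<^sub>R whitney_face T n v lam C f) =
      (\<Sum>f\<in>faces T. b g *\<^sub>R whitney_face T n v lam C f)"
      by (intro sum.cong refl) (metis const g)
    then show ?thesis by (simp add: sum_whitney_face flip: scaleR_sum_right)
  qed simp
  show ?thesis unfolding field_def A B by simp
qed

text \<open>It suffices that a z orthogonal to all columns vanishes. Orthogonality to the face
  columns says that z divided by the edge lengths is closed, hence exact; orthogonality to the
  vertex columns then makes it orthogonal to itself.\<close>

lemma dofs_surjective: "\<exists>a b. \<forall>e\<in>Ep. dofs a b e = y e"
proof -
  let ?V = "\<lambda>i e. vertex_entry v e i" and ?F = "\<lambda>f e. face_entry T n v e f"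
  obtain w where w: "w \<in> span (?V ` {1..n} \<union> ?F ` faces T)" "\<And>e. e \<in> Ep \<Longrightarrow> w e = y e"
  proof (rule finite_fredholm_alternative[OF finite_Ep, where y = y])
    fix z assume z: "\<And>u. u \<in> ?V ` {1..n} \<union> ?F ` faces T \<Longrightarrow> (\<Sum>e\<in>Ep. z e * u e) = 0"
    \<comment> \<open>The function z / \<open>len\<close>, extended antisymmetrically to both
      directions of each edge; the value 0 elsewhere is a default.\<close>
    define \<alpha> where "\<alpha> i j = (if (i, j) \<in> Ep then z (i, j) / len (i, j)
      else if (j, i) \<in> Ep then - z (j, i) / len (j, i) else 0)" for i j
    have anti: "\<alpha> j i = - \<alpha> i j" if "(i, j) \<in> E" for i j
      using Ep_swap[OF that] by (auto simp: \<alpha>_def)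
    have "(\<Sum>(i, j)\<in>bd f. \<alpha> i j) = 0" if f: "f \<in> faces T" for f
    proof -
      have "(\<Sum>(i, j)\<in>bd f. \<alpha> i j) = (\<Sum>e\<in>Ep. incidence f e * (case e of (i, j) \<Rightarrow> \<alpha> i j))"
        by (rule sum_incidence[OF f, symmetric]) (simp add: anti)
      also have "\<dots> = (\<Sum>e\<in>Ep. z e * face_entry T n v e f)"
        by (intro sum.cong) (auto simp: \<alpha>_def face_entry_eq)
      also have "\<dots> = 0" using z f by blast
      finally show ?thesis .
    qed
    then obtain \<phi> where \<phi>: "\<And>i j. (i, j) \<in> E \<Longrightarrow> \<alpha> i j = \<phi> j - \<phi> i"
      using closed_imp_exact[of \<alpha>] anti by metis
    have "(\<Sum>e\<in>Ep. (z e / len e)\<^sup>2) = (\<Sum>e\<in>Ep. z e * (\<Sum>i\<in>{1..n}. vertex_entry v e i * \<phi> i))"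
    proof (intro sum.cong refl)
      fix e assume e: "e \<in> Ep"
      then have "\<phi> (snd e) - \<phi> (fst e) = z e / len e"
        using \<phi>[of "fst e" "snd e"] Ep_subset by (auto simp: \<alpha>_def)
      moreover have "e \<in> E" using e Ep_subset by blast
      ultimately show "(z e / len e)\<^sup>2 = z e * (\<Sum>i\<in>{1..n}. vertex_entry v e i * \<phi> i)"
        by (simp only: vertex_entry_sum power2_eq_square) simp
    qed
    also have "\<dots> = (\<Sum>e\<in>Ep. \<Sum>i\<in>{1..n}. \<phi> i * (z e * vertex_entry v e i))"
      unfolding sum_distrib_left by (intro sum.cong refl) simp
    also have "\<dots> = (\<Sum>i\<in>{1..n}. \<phi> i * (\<Sum>e\<in>Ep. z e * vertex_entry v e i))"
      by (subst sum.swap) (simp add: sum_distrib_left)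
    also have "\<dots> = 0"
    proof (intro sum.neutral ballI)
      fix i assume "i \<in> {1..n}"
      then have "(\<Sum>e\<in>Ep. z e * vertex_entry v e i) = 0" by (intro z[of "?V i"]) blast
      then show "\<phi> i * (\<Sum>e\<in>Ep. z e * vertex_entry v e i) = 0" by simp
    qed
    finally have "\<forall>e\<in>Ep. (z e / len e)\<^sup>2 = 0"
      using finite_Ep by (subst (asm) sum_nonneg_eq_0_iff) auto
    then show "\<forall>e\<in>Ep. z e = 0" using len_pos Ep_subset by fastforce
  qed blast
  obtain u u' where u: "u \<in> span (?V ` {1..n})" "u' \<in> span (?F ` faces T)" "w = u + u'"
    using w(1) unfolding span_Un by blast
  obtain a where a: "u = (\<Sum>i\<in>{1..n}. a i *\<^sub>R ?V i)"
    using u(1) span_image_eq_range_sum[of "{1..n}" ?V] by auto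
  obtain b where b: "u' = (\<Sum>f\<in>faces T. b f *\<^sub>R ?F f)"
    using u(2) span_image_eq_range_sum[OF finite_faces, of ?F] by auto
  have "dofs a b e = w e" for e
    by (simp add: dofs_def u(3) a b sum_fun_apply scaleR_fun_def mult.commute)
  then show ?thesis using w(2) by metis
qed

section \<open>The dual basis\<close>

lemma M1_eq_range: "M1 T n v lam C = {field a b | a b. True}"
  unfolding M1_def field_def
  unfolding span_image_eq_range_sum[OF finite_faces] span_image_eq_range_sum[OF finite_atLeastAtMost]
  by blast

lemma field_sum:
  "field (\<lambda>i. \<Sum>e\<in>I. y e * a e i) (\<lambda>f. \<Sum>e\<in>I. y e * b e f) = (\<Sum>e\<in>I. y e *\<^sub>R field (a e) (b e))"
proof -
  have "(\<Sum>e\<in>I. y e *\<^sub>R field (a e) (b e)) =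
    (\<Sum>e\<in>I. \<Sum>i\<in>{1..n}. (y e * a e i) *\<^sub>R grad_on T (lam i)) +
    (\<Sum>e\<in>I. \<Sum>f\<in>faces T. (y e * b e f) *\<^sub>R whitney_face T n v lam C f)"
    by (simp add: field_def scaleR_add_right scaleR_sum_right sum.distrib)
  also have "\<dots> = (\<Sum>i\<in>{1..n}. \<Sum>e\<in>I. (y e * a e i) *\<^sub>R grad_on T (lam i)) +
    (\<Sum>f\<in>faces T. \<Sum>e\<in>I. (y e * b e f) *\<^sub>R whitney_face T n v lam C f)"
    by (simp only: sum.swap[of _ I])
  finally show ?thesis by (simp add: field_def scaleR_left.sum)
qed

lemma dofs_sum:
  "dofs (\<lambda>i. \<Sum>e\<in>I. y e * a e i) (\<lambda>f. \<Sum>e\<in>I. y e * b e f) e' = (\<Sum>e\<in>I. y e * dofs (a e) (b e) e')"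
proof -
  have "(\<Sum>e\<in>I. y e * dofs (a e) (b e) e') =
    (\<Sum>e\<in>I. \<Sum>i\<in>{1..n}. vertex_entry v e' i * (y e * a e i)) +
    (\<Sum>e\<in>I. \<Sum>f\<in>faces T. face_entry T n v e' f * (y e * b e f))"
    by (simp add: dofs_def distrib_left sum_distrib_left sum.distrib algebra_simps)
  also have "\<dots> = (\<Sum>i\<in>{1..n}. \<Sum>e\<in>I. vertex_entry v e' i * (y e * a e i)) +
    (\<Sum>f\<in>faces T. \<Sum>e\<in>I. face_entry T n v e' f * (y e * b e f))"
    by (simp only: sum.swap[of _ I])
  finally show ?thesis by (simp add: dofs_def sum_distrib_left)
qed

lemma card_Ep: "card Ep = card {s. s edge_of T}"
proof (rule bij_betw_same_card[of "seg v"])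
  show "bij_betw (seg v) Ep {s. s edge_of T}"
  proof (rule bij_betw_imageI)
    show "inj_on (seg v) Ep"
    proof (rule inj_onI)
      fix e e' assume e: "e \<in> Ep" "e' \<in> Ep" "seg v e = seg v e'"
      obtain i j k l where ij: "e = (i, j)" "e' = (k, l)" by (cases e, cases e')
      have E: "(i, j) \<in> E" "(k, l) \<in> E" using e ij Ep_subset by auto
      then have "i = k \<and> j = l \<or> i = l \<and> j = k"
        using e(3) ij seg_eq_iff by (simp add: edges_iff)
      then show "e = e'" using Ep_swap[OF E(1)] e ij by auto
    qed
    show "seg v ` Ep = {s. s edge_of T}"
    proof
      show "seg v ` Ep \<subseteq> {s. s edge_of T}" using Ep_subset by (auto simp: edges_def)
      show "{s. s edge_of T} \<subseteq> seg v ` Ep"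
      proof
        fix s assume "s \<in> {s. s edge_of T}"
        then obtain i j where ij: "(i, j) \<in> E" "s = seg v (i, j)" using edge_ex_seg by blast
        then have "(i, j) \<in> Ep \<or> (j, i) \<in> Ep" using Ep_swap by blast
        then show "s \<in> seg v ` Ep" using ij(2) seg_commute[of i j] by (metis imageI)
      qed
    qed
  qed
qed

text \<open>One solution per edge defines p; any other solution has the same edge values and
  therefore gives the same field.\<close>

lemma edge_basis:
  obtains p where "inj_on p Ep" "independent (p ` Ep)" "span (p ` Ep) = M1 T n v lam C"
    "\<And>e e' x. e \<in> Ep \<Longrightarrow> e' \<in> Ep \<Longrightarrow> x \<in> seg v e' \<Longrightarrow> p e x \<bullet> unit_tangent v e' = (if e = e' then 1 else 0)"
    "\<And>e. e \<in> Ep \<Longrightarrow> \<exists>a b. solves_edge_system T n v Ep e a b"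
    "\<And>e a b. e \<in> Ep \<Longrightarrow> solves_edge_system T n v Ep e a b \<Longrightarrow> p e = field a b"
proof -
  have solves: "solves_edge_system T n v Ep e a b \<longleftrightarrow> (\<forall>e'\<in>Ep. dofs a b e' = (if e = e' then 1 else 0))"
    for e a b by (simp add: solves_edge_system_def dofs_def)
  have "\<forall>e. \<exists>a b. \<forall>e'\<in>Ep. dofs a b e' = (if e = e' then 1 else 0)"
    by (intro allI dofs_surjective)
  then obtain a b where "\<forall>e. \<forall>e'\<in>Ep. dofs (a e) (b e) e' = (if e = e' then 1 else 0)"
    unfolding choice_iff by blast
  then have ab: "dofs (a e) (b e) e' = (if e = e' then 1 else 0)" if "e' \<in> Ep" for e e'
    using that by blast
  define p where "p e = field (a e) (b e)" for e
  have unique: "field a' b' = field a'' b''" if "\<And>e. e \<in> Ep \<Longrightarrow> dofs a' b' e = dofs a'' b'' e" for a' b' a'' b''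
    using field_eq_0[of "\<lambda>i. a' i - a'' i" "\<lambda>f. b' f - b'' f"] that by (simp add: dofs_diff field_diff)
  have tang: "p e x \<bullet> unit_tangent v e' = (if e = e' then 1 else 0)"
    if "e' \<in> Ep" "x \<in> seg v e'" for e e' x
  proof -
    have "e' \<in> E" using that(1) Ep_subset by blast
    then show ?thesis by (simp only: p_def field_edge[OF _ that(2)] ab[OF that(1)])
  qed
  have end_seg: "v (fst e) \<in> seg v e" for e by (simp add: seg_def)
  \<comment> \<open>The tangential component at the start of one edge is a linear functional; it
    separates \<open>p e\<close> from the span of the others.\<close>
  have sub: "subspace {u :: real^3 \<Rightarrow> real^3. u x \<bullet> w = 0}" for x w
    by (rule subspaceI) (auto simp: inner_add_left scaleR_fun_def)
  have inj: "inj_on p Ep"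
    using tang[OF _ end_seg] by (intro inj_onI) (metis zero_neq_one)
  have ind: "independent (p ` Ep)"
    unfolding dependent_def
  proof clarify
    fix e assume e: "e \<in> Ep" "p e \<in> span (p ` Ep - {p e})"
    have "span (p ` Ep - {p e}) \<subseteq> {u. u (v (fst e)) \<bullet> unit_tangent v e = 0}"
      by (rule span_minimal[OF _ sub]) (use tang[OF e(1) end_seg] in auto)
    then show False using e tang[OF e(1) end_seg, of e] by auto
  qed
  have "span (p ` Ep) = M1 T n v lam C"
    unfolding span_image_eq_range_sum[OF finite_Ep] M1_eq_range
  proof safe
    fix y
    show "\<exists>a' b'. (\<Sum>e\<in>Ep. y e *\<^sub>R p e) = field a' b' \<and> True"
      unfolding p_def by (intro exI conjI TrueI) (rule field_sum[symmetric])
  next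
    fix a' b'
    \<comment> \<open>Interpolation: weighting the \<open>p e\<close> by the edge values of the
      given field reproduces these values, hence the field.\<close>
    have "field a' b' = field (\<lambda>i. \<Sum>e\<in>Ep. dofs a' b' e * a e i) (\<lambda>f. \<Sum>e\<in>Ep. dofs a' b' e * b e f)"
    proof (rule unique)
      fix e' assume e': "e' \<in> Ep"
      have "(\<Sum>e\<in>Ep. dofs a' b' e * dofs (a e) (b e) e') = (\<Sum>e\<in>Ep. if e = e' then dofs a' b' e else 0)"
        by (intro sum.cong) (auto simp: ab[OF e'])
      then show "dofs a' b' e' = dofs (\<lambda>i. \<Sum>e\<in>Ep. dofs a' b' e * a e i) (\<lambda>f. \<Sum>e\<in>Ep. dofs a' b' e * b e f) e'"
        using e' finite_Ep by (simp add: dofs_sum)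
    qed
    then have "field a' b' = (\<Sum>e\<in>Ep. dofs a' b' e *\<^sub>R p e)" by (simp add: field_sum p_def)
    then show "field a' b' \<in> range (\<lambda>y. \<Sum>e\<in>Ep. y e *\<^sub>R p e)" by blast
  qed
  moreover have "p e = field a' b'" if "solves_edge_system T n v Ep e a' b'" for e a' b'
    unfolding p_def using that ab by (intro unique) (simp add: solves)
  moreover have "solves_edge_system T n v Ep e (a e) (b e)" for e using ab by (simp add: solves)
  ultimately show thesis using that[of p] inj ind tang by blast
qed

end

theorem lemma4p7:
  fixes T :: "(real^3) set" and n :: nat and v :: "nat \<Rightarrow> real^3"
    and lam :: "nat \<Rightarrow> real^3 \<Rightarrow> real"
    and C :: "nat \<Rightarrow> nat \<Rightarrow> nat \<Rightarrow> real" and Ep :: "(nat \<times> nat) set"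
  assumes "convex_polyhedron T n v"
    and "gbc T {1..n} v lam"
    and "assumption1 T n v lam"
    and "assumption2 T n v lam"
    and "diagonal_coeffs T n v C"
    and "edge_orientation T n v Ep"
  shows "(\<exists>p :: nat \<times> nat \<Rightarrow> real^3 \<Rightarrow> real^3.
            inj_on p Ep \<and> independent (p ` Ep) \<and> span (p ` Ep) = M1 T n v lam C \<and>
            (\<forall>e\<in>Ep. \<forall>e'\<in>Ep. \<forall>x\<in>seg v e'. p e x \<bullet> unit_tangent v e' = (if e = e' then 1 else 0)) \<and>
            (\<forall>e\<in>Ep.
               (\<exists>a b. solves_edge_system T n v Ep e a b) \<and>
               (\<forall>a b. solves_edge_system T n v Ep e a b \<longrightarrow>
                  p e = (\<Sum>i\<in>{1..n}. a i *\<^sub>R grad_on T (lam i))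
                        + (\<Sum>f\<in>faces T. b f *\<^sub>R whitney_face T n v lam C f))))
         \<and> dim (M1 T n v lam C) = card {s. s edge_of T}"
proof -
  interpret barycentric_polyhedron T n v lam C Ep
    using assms by unfold_locales
  obtain p where p: "inj_on p Ep" "independent (p ` Ep)" "span (p ` Ep) = M1 T n v lam C"
    "\<And>e e' x. e \<in> Ep \<Longrightarrow> e' \<in> Ep \<Longrightarrow> x \<in> seg v e' \<Longrightarrow> p e x \<bullet> unit_tangent v e' = (if e = e' then 1 else 0)"
    "\<And>e. e \<in> Ep \<Longrightarrow> \<exists>a b. solves_edge_system T n v Ep e a b"
    "\<And>e a b. e \<in> Ep \<Longrightarrow> solves_edge_system T n v Ep e a b \<Longrightarrow> p e = field a b"
    using edge_basis by blast
  have "dim (M1 T n v lam C) = card (p ` Ep)"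
    using dim_span_eq_card_independent[OF p(2)] p(3) by simp
  also have "\<dots> = card {s. s edge_of T}" using p(1) by (simp add: card_image card_Ep)
  finally show ?thesis
    using p unfolding field_def by (intro conjI exI[of _ p]) blast+
qed

end
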